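(* Suppose $\bar{\mathcal P}$ (with its describing polynomial constraints given in the context) is Archimedean. Let $\gamma^*$ be the optimal value of $$\gamma^*=\min_{\gamma\in\mathbb{R},\ (\tilde a,\tilde b)\in\mathbb{R}^{\tilde n_a}\times\mathbb{R}^{\tilde n_b}}\ \gamma\quad\text{subject to}\quad \gamma\ge\|a^{cl}\|_1\ \ \ \forall(a,b,\Delta u,\Delta y)\in\bar{\mathcal P},$$ and for each positive integer $d$ let $\gamma_d^*$ be the optimal value of the sum-of-squares program $$\begin{aligned}\gamma_d^*=\min\ \ &\gamma\\ \text{over}\ \ &\gamma\in\mathbb{R},\ \tilde a\in\mathbb{R}^{\tilde n_a},\ \tilde b\in\mathbb{R}^{\tilde n_b},\ m_i\in\mathbb{R}[a,b]_{\le 2d}\ (i=1,\dots,n_{cl})\\ \text{subject to}\ \ &\gamma-\textstyle\sum_{i=1}^{n_{cl}}m_i(a,b)\in\Sigma[\bar{\mathcal P}]_{\le2d},\\ &m_i(a,b)-a_i^{cl}(a,b)\in\Sigma[\bar{\mathcal P}]_{\le2d}\quad\forall i=1,\dots,n_{cl},\\ &m_i(a,b)+a_i^{cl}(a,b)\in\Sigma[\bar{\mathcal P}]_{\le2d}\quad\forall i=1,\dots,n_{cl}.\end{aligned}$$ Then $\gamma_d^*\ge\gamma_{d+1}^*\ge\cdots\ge\gamma^*$ for every $d$, and $\lim_{d\to\infty}\gamma_d^*=\gamma^*$.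
   Context: Data and consistency set. Fix integers $n_a>n_b\ge1$, a horizon $T\ge1$, noise bounds $\epsilon_u,\epsilon_y\ge0$, and recorded data $\hat u=(\hat u_t)_{t=-n_b+1}^{T-1}$, $\hat y=(\hat y_t)_{t=-n_a+1}^{T}$. The data are noisy records $\hat u=u+\Delta u$, $\hat y=y+\Delta y$ (with $\|\Delta u\|_\infty\le\epsilon_u$, $\|\Delta y\|_\infty\le\epsilon_y$) of a trajectory of some ground-truth ARX model $y_t=-\sum_{i=1}^{n_a}a_iy_{t-i}+\sum_{i=1}^{n_b}b_iu_{t-i}$, $t=1,\dots,T$ (so the set $\bar{\mathcal P}$ below is nonempty). For $a\in\mathbb{R}^{n_a}$, $b\in\mathbb{R}^{n_b}$ put $h_t(a,b)=\hat y_t+\sum_{i=1}^{n_a}a_i\hat y_{t-i}-\sum_{i=1}^{n_b}b_i\hat u_{t-i}$. The set $\bar{\mathcal P}$ consists of all $(a,b,\Delta u,\Delta y)$ with $a\in\mathbb{R}^{n_a}$, $b\in\mathbb{R}^{n_b}$, $\Delta u=(\Delta u_t)_{t=-n_b+1}^{T-1}\in\mathbb{R}^{T+n_b-1}$, $\Delta y=(\Delta y_t)_{t=-n_a+1}^{T}\in\mathbb{R}^{T+n_a}$ satisfying the polynomial inequalities $\epsilon_u-\Delta u_t\ge0$, $\epsilon_u+\Delta u_t\ge0$ (all $t=-n_b+1,\dots,T-1$), $\epsilon_y-\Delta y_t\ge0$, $\epsilon_y+\Delta y_t\ge0$ (all $t=-n_a+1,\dots,T$), and the polynomial equalities $$0=h_t(a,b)-\sum_{i=1}^{n_a}a_i\Delta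 y_{t-i}+\sum_{i=1}^{n_b}b_i\Delta u_{t-i}-\Delta y_t\qquad t=1,\dots,T.$$ Closed loop. Fix controller lengths $\tilde n_a>\tilde n_b\ge1$ and set $n_{cl}=n_a+\tilde n_a$. With $A(\lambda)=\sum_{i=1}^{n_a}a_i\lambda^i$, $B(\lambda)=\sum_{i=1}^{n_b}b_i\lambda^i$, $\tilde A(\lambda)=\sum_{i=1}^{\tilde n_a}\tilde a_i\lambda^i$, $\tilde B(\lambda)=\sum_{i=1}^{\tilde n_b}\tilde b_i\lambda^i$, the vector $a^{cl}=a^{cl}(a,b)\in\mathbb{R}^{n_{cl}}$ (depending also on $(\tilde a,\tilde b)$) has as $i$-th entry the coefficient of $\lambda^i$ in $(1+A(\lambda))(1+\tilde A(\lambda))+B(\lambda)\tilde B(\lambda)-1$. Sum-of-squares notation. $\mathbb{R}[x]_{\le k}$ is the set of real polynomials in $x$ of degree at most $k$; $\Sigma[x]$ is the set of sums of squares of real polynomials. For a set $\mathbb K=\{x\in\mathbb{R}^n: g_k(x)\ge0\ (k=1,\dots,N_g),\ h_j(x)=0\ (j=1,\dots,N_h)\}$ described by polynomials, $\Sigma[\mathbb K]$ is the set of polynomials of the form $p=\sigma_0+\sum_k\sigma_kg_k+\sum_j\phi_jh_j$ with $\sigma_0,\sigma_k\in\Sigma[x]$ and $\phi_j\in\mathbb{R}[x]$, and $\Sigma[\mathbb K]_{\le2d}$ is the subset of those admitting such a representation with $\sigma_0$, every $\sigma_kg_k$ and every $\phi_jh_j$ of degree at most $2d$. $\mathbb K$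 is Archimedean if there is $R>0$ with $R-\|x\|_2^2\in\Sigma[\mathbb K]$. For $\bar{\mathcal P}$ the variable is $x=(a,b,\Delta u,\Delta y)$ and the describing polynomials are those listed above. The optimal value of an infeasible program is $+\infty$; "min" denotes the optimal value (infimum). *)

theory Defs
  imports "HOL-Analysis.Analysis" "HOL-Library.Poly_Mapping"
    "HOL-Computational_Algebra.Polynomial"
begin

section \<open>Real polynomials in several variables\<close>

text \<open>
  Variables are the elements of a type \<open>'v\<close>; a monomial is its finitely supported exponent
  function, and a polynomial is a finitely supported family of coefficients. The product on
  \<open>'v mpoly\<close> is the convolution product, so this is the usual commutative polynomial ring.
\<close>

type_synonym 'v mpoly = "('v \<Rightarrow>\<^sub>0 nat) \<Rightarrow>\<^sub>0 real"

definition mvar :: "'v \<Rightarrow> 'v mpoly" where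
  "mvar v = Poly_Mapping.single (Poly_Mapping.single v 1) 1"

definition mconst :: "real \<Rightarrow> 'v mpoly" where
  "mconst c = Poly_Mapping.single 0 c"

definition mon_eval :: "('v \<Rightarrow> real) \<Rightarrow> ('v \<Rightarrow>\<^sub>0 nat) \<Rightarrow> real" where
  "mon_eval x m = (\<Prod>v\<in>Poly_Mapping.keys m. x v ^ Poly_Mapping.lookup m v)"

definition meval :: "('v \<Rightarrow> real) \<Rightarrow> 'v mpoly \<Rightarrow> real" where
  "meval x p = (\<Sum>m\<in>Poly_Mapping.keys p. Poly_Mapping.lookup p m * mon_eval x m)"

definition mon_degree :: "('v \<Rightarrow>\<^sub>0 nat) \<Rightarrow> nat" where
  "mon_degree m = (\<Sum>v\<in>Poly_Mapping.keys m. Poly_Mapping.lookup m v)"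

text \<open>Total degree at most \<open>k\<close>; the zero polynomial satisfies this for every \<open>k\<close>.\<close>

definition deg_le :: "'v mpoly \<Rightarrow> nat \<Rightarrow> bool" where
  "deg_le p k \<longleftrightarrow> (\<forall>m\<in>Poly_Mapping.keys p. mon_degree m \<le> k)"

text \<open>The ring of polynomials in which only the variables from \<open>V\<close> occur.\<close>

definition polys :: "'v set \<Rightarrow> 'v mpoly set" where
  "polys V = {p. \<forall>m\<in>Poly_Mapping.keys p. Poly_Mapping.keys m \<subseteq> V}"

definition polys_le :: "'v set \<Rightarrow> nat \<Rightarrow> 'v mpoly set" where
  "polys_le V k = {p \<in> polys V. deg_le p k}"


section \<open>Sums of squares and quadratic modules\<close>

definition sos :: "'v set \<Rightarrow> 'v mpoly set" where
  "sos V = {(\<Sum>i<n. (q i)\<^sup>2) | (n::nat) q. \<forall>i<n. q i \<in> polys V}"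

text \<open>
  A description of a semialgebraic set in the variables \<open>V\<close> is a list \<open>gs\<close> of polynomials required
  to be nonnegative and a list \<open>hs\<close> of polynomials required to vanish. Points are functions on
  \<open>V\<close>, extended by \<open>undefined\<close>, i.e. elements of \<open>V \<rightarrow>\<^sub>E UNIV\<close>.
\<close>

definition semialg :: "'v set \<Rightarrow> 'v mpoly list \<Rightarrow> 'v mpoly list \<Rightarrow> ('v \<Rightarrow> real) set" where
  "semialg V gs hs =
    {x \<in> V \<rightarrow>\<^sub>E UNIV. (\<forall>g\<in>set gs. meval x g \<ge> 0) \<and> (\<forall>h\<in>set hs. meval x h = 0)}"

text \<open>
  \<open>qmod V gs hs\<close> and \<open>qmod_le V gs hs k\<close> are $\Sigma[K]$ and $\Sigma[K]_{\le k}$ for the set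
  $K$ described by \<open>gs\<close> and \<open>hs\<close>; both depend on the description and not only on $K$.
\<close>

definition qmod :: "'v set \<Rightarrow> 'v mpoly list \<Rightarrow> 'v mpoly list \<Rightarrow> 'v mpoly set" where
  "qmod V gs hs =
    {\<sigma>0 + (\<Sum>k<length gs. \<sigma> k * gs ! k) + (\<Sum>j<length hs. \<phi> j * hs ! j) | \<sigma>0 \<sigma> \<phi>.
       \<sigma>0 \<in> sos V \<and> (\<forall>k<length gs. \<sigma> k \<in> sos V) \<and> (\<forall>j<length hs. \<phi> j \<in> polys V)}"

definition qmod_le :: "'v set \<Rightarrow> 'v mpoly list \<Rightarrow> 'v mpoly list \<Rightarrow> nat \<Rightarrow> 'v mpoly set" where
  "qmod_le V gs hs D =
    {\<sigma>0 + (\<Sum>k<length gs. \<sigma> k * gs ! k) + (\<Sum>j<length hs. \<phi> j * hs ! j) | \<sigma>0 \<sigma> \<phi>.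
       \<sigma>0 \<in> sos V \<and> (\<forall>k<length gs. \<sigma> k \<in> sos V) \<and> (\<forall>j<length hs. \<phi> j \<in> polys V) \<and>
       deg_le \<sigma>0 D \<and> (\<forall>k<length gs. deg_le (\<sigma> k * gs ! k) D) \<and>
       (\<forall>j<length hs. deg_le (\<phi> j * hs ! j) D)}"

definition archimedean :: "'v set \<Rightarrow> 'v mpoly list \<Rightarrow> 'v mpoly list \<Rightarrow> bool" where
  "archimedean V gs hs \<longleftrightarrow> (\<exists>R>0. mconst R - (\<Sum>v\<in>V. (mvar v)\<^sup>2) \<in> qmod V gs hs)"


section \<open>The errors-in-variables ARX consistency set\<close>

text \<open>
  Signals are functions on \<open>int\<close>: inputs are used only at times \<open>1 - nb, \<dots>, T - 1\<close> and outputs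
  only at times \<open>1 - na, \<dots>, T\<close>. Model coefficients are functions on \<open>nat\<close>, used from index 1 on.
\<close>

definition arx_trajectory ::
    "nat \<Rightarrow> nat \<Rightarrow> nat \<Rightarrow> (nat \<Rightarrow> real) \<Rightarrow> (nat \<Rightarrow> real) \<Rightarrow> (int \<Rightarrow> real) \<Rightarrow> (int \<Rightarrow> real) \<Rightarrow> bool" where
  "arx_trajectory na nb T a b u y \<longleftrightarrow>
    (\<forall>t\<in>{1..int T}. y t = - (\<Sum>i=1..na. a i * y (t - int i)) + (\<Sum>i=1..nb. b i * u (t - int i)))"

definition data_from_arx ::
    "nat \<Rightarrow> nat \<Rightarrow> nat \<Rightarrow> real \<Rightarrow> real \<Rightarrow> (int \<Rightarrow> real) \<Rightarrow> (int \<Rightarrow> real) \<Rightarrow> bool" where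
  "data_from_arx na nb T \<epsilon>u \<epsilon>y uh yh \<longleftrightarrow>
    (\<exists>a b u y \<Delta>u \<Delta>y.
       arx_trajectory na nb T a b u y \<and>
       (\<forall>t\<in>{1 - int nb..int T - 1}. uh t = u t + \<Delta>u t \<and> \<bar>\<Delta>u t\<bar> \<le> \<epsilon>u) \<and>
       (\<forall>t\<in>{1 - int na..int T}. yh t = y t + \<Delta>y t \<and> \<bar>\<Delta>y t\<bar> \<le> \<epsilon>y))"

text \<open>The indeterminates $a_i$, $b_i$, $\Delta u_t$, $\Delta y_t$.\<close>

datatype arx_var = VA nat | VB nat | VU int | VY int

definition ab_vars :: "nat \<Rightarrow> nat \<Rightarrow> arx_var set" where
  "ab_vars na nb = VA ` {1..na} \<union> VB ` {1..nb}"

definition arx_vars :: "nat \<Rightarrow> nat \<Rightarrow> nat \<Rightarrow> arx_var set" where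
  "arx_vars na nb T =
    ab_vars na nb \<union> VU ` {1 - int nb..int T - 1} \<union> VY ` {1 - int na..int T}"

definition Pbar_ineqs :: "nat \<Rightarrow> nat \<Rightarrow> nat \<Rightarrow> real \<Rightarrow> real \<Rightarrow> arx_var mpoly list" where
  "Pbar_ineqs na nb T \<epsilon>u \<epsilon>y =
     map (\<lambda>t. mconst \<epsilon>u - mvar (VU t)) [1 - int nb..int T - 1] @
     map (\<lambda>t. mconst \<epsilon>u + mvar (VU t)) [1 - int nb..int T - 1] @
     map (\<lambda>t. mconst \<epsilon>y - mvar (VY t)) [1 - int na..int T] @
     map (\<lambda>t. mconst \<epsilon>y + mvar (VY t)) [1 - int na..int T]"

definition h_poly ::
    "nat \<Rightarrow> nat \<Rightarrow> (int \<Rightarrow> real) \<Rightarrow> (int \<Rightarrow> real) \<Rightarrow> int \<Rightarrow> arx_var mpoly" where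
  "h_poly na nb uh yh t =
     mconst (yh t) + (\<Sum>i=1..na. mvar (VA i) * mconst (yh (t - int i)))
       - (\<Sum>i=1..nb. mvar (VB i) * mconst (uh (t - int i)))"

definition Pbar_eqs ::
    "nat \<Rightarrow> nat \<Rightarrow> nat \<Rightarrow> (int \<Rightarrow> real) \<Rightarrow> (int \<Rightarrow> real) \<Rightarrow> arx_var mpoly list" where
  "Pbar_eqs na nb T uh yh =
     map (\<lambda>t. h_poly na nb uh yh t - (\<Sum>i=1..na. mvar (VA i) * mvar (VY (t - int i)))
                + (\<Sum>i=1..nb. mvar (VB i) * mvar (VU (t - int i))) - mvar (VY t)) [1..int T]"

definition Pbar ::
    "nat \<Rightarrow> nat \<Rightarrow> nat \<Rightarrow> real \<Rightarrow> real \<Rightarrow> (int \<Rightarrow> real) \<Rightarrow> (int \<Rightarrow> real) \<Rightarrow> (arx_var \<Rightarrow> real) set" where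
  "Pbar na nb T \<epsilon>u \<epsilon>y uh yh =
     semialg (arx_vars na nb T) (Pbar_ineqs na nb T \<epsilon>u \<epsilon>y) (Pbar_eqs na nb T uh yh)"


section \<open>Closed loop and the two optimization problems\<close>

definition lag_poly :: "nat \<Rightarrow> (nat \<Rightarrow> 'r::comm_ring_1) \<Rightarrow> 'r poly" where
  "lag_poly n c = (\<Sum>i=1..n. Polynomial.monom (c i) i)"

text \<open>
  The closed-loop coefficients are defined over an arbitrary commutative ring: over \<open>real\<close> they
  give the numbers $a^{cl}_i$, over \<open>arx_var mpoly\<close> the polynomials $a^{cl}_i(a,b)$.
\<close>

definition acl ::
    "nat \<Rightarrow> nat \<Rightarrow> nat \<Rightarrow> nat \<Rightarrow> (nat \<Rightarrow> 'r::comm_ring_1) \<Rightarrow> (nat \<Rightarrow> 'r) \<Rightarrow> (nat \<Rightarrow> 'r) \<Rightarrow> (nat \<Rightarrow> 'r)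
      \<Rightarrow> nat \<Rightarrow> 'r" where
  "acl na nb nta ntb a b ta tb i =
     Polynomial.coeff ((1 + lag_poly na a) * (1 + lag_poly nta ta)
                         + lag_poly nb b * lag_poly ntb tb - 1) i"

definition acl_poly ::
    "nat \<Rightarrow> nat \<Rightarrow> nat \<Rightarrow> nat \<Rightarrow> (nat \<Rightarrow> real) \<Rightarrow> (nat \<Rightarrow> real) \<Rightarrow> nat \<Rightarrow> arx_var mpoly" where
  "acl_poly na nb nta ntb ta tb =
     acl na nb nta ntb (\<lambda>i. mvar (VA i)) (\<lambda>i. mvar (VB i)) (\<lambda>i. mconst (ta i)) (\<lambda>i. mconst (tb i))"

text \<open>
  Optimal values are infima in \<open>ereal\<close>, so that the value of an infeasible program is $+\infty$.
\<close>

definition gamma_star ::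
    "nat \<Rightarrow> nat \<Rightarrow> nat \<Rightarrow> nat \<Rightarrow> nat \<Rightarrow> real \<Rightarrow> real \<Rightarrow> (int \<Rightarrow> real) \<Rightarrow> (int \<Rightarrow> real) \<Rightarrow> ereal" where
  "gamma_star na nb nta ntb T \<epsilon>u \<epsilon>y uh yh =
     Inf {ereal \<gamma> | \<gamma> ta tb.
       ta \<in> {1..nta} \<rightarrow>\<^sub>E UNIV \<and> tb \<in> {1..ntb} \<rightarrow>\<^sub>E UNIV \<and>
       (\<forall>x\<in>Pbar na nb T \<epsilon>u \<epsilon>y uh yh.
          \<gamma> \<ge> (\<Sum>i=1..na+nta. \<bar>acl na nb nta ntb (\<lambda>i. x (VA i)) (\<lambda>i. x (VB i)) ta tb i\<bar>))}"

definition gamma_sos ::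
    "nat \<Rightarrow> nat \<Rightarrow> nat \<Rightarrow> nat \<Rightarrow> nat \<Rightarrow> real \<Rightarrow> real \<Rightarrow> (int \<Rightarrow> real) \<Rightarrow> (int \<Rightarrow> real) \<Rightarrow> nat \<Rightarrow> ereal" where
  "gamma_sos na nb nta ntb T \<epsilon>u \<epsilon>y uh yh d =
     (let Q = qmod_le (arx_vars na nb T) (Pbar_ineqs na nb T \<epsilon>u \<epsilon>y) (Pbar_eqs na nb T uh yh) (2 * d)
      in Inf {ereal \<gamma> | \<gamma> ta tb m.
           ta \<in> {1..nta} \<rightarrow>\<^sub>E UNIV \<and> tb \<in> {1..ntb} \<rightarrow>\<^sub>E UNIV \<and>
           (\<forall>i\<in>{1..na+nta}. m i \<in> polys_le (ab_vars na nb) (2 * d)) \<and>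
           mconst \<gamma> - (\<Sum>i=1..na+nta. m i) \<in> Q \<and>
           (\<forall>i\<in>{1..na+nta}. m i - acl_poly na nb nta ntb ta tb i \<in> Q) \<and>
           (\<forall>i\<in>{1..na+nta}. m i + acl_poly na nb nta ntb ta tb i \<in> Q)})"


section \<open>Evaluation is a ring homomorphism; explicit forms\<close>

lemma keys_nat_add:
  fixes m n :: "'v \<Rightarrow>\<^sub>0 nat"
  shows "Poly_Mapping.keys (m + n) = Poly_Mapping.keys m \<union> Poly_Mapping.keys n"
  by (auto simp: in_keys_iff lookup_add)

lemma mon_eval_superset:
  assumes "finite S" "Poly_Mapping.keys m \<subseteq> S"
  shows "mon_eval x m = (\<Prod>v\<in>S. x v ^ Poly_Mapping.lookup m v)"
  unfolding mon_eval_def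
  by (rule prod.mono_neutral_left) (use assms in \<open>auto simp: in_keys_iff\<close>)

lemma mon_eval_0 [simp]: "mon_eval x 0 = 1"
  by (simp add: mon_eval_def)

lemma mon_eval_add: "mon_eval x (m + n) = mon_eval x m * mon_eval x n"
proof -
  let ?S = "Poly_Mapping.keys m \<union> Poly_Mapping.keys n"
  have "mon_eval x (m + n) = (\<Prod>v\<in>?S. x v ^ Poly_Mapping.lookup (m + n) v)"
    by (rule mon_eval_superset) (auto simp: keys_nat_add)
  also have "\<dots> = (\<Prod>v\<in>?S. x v ^ Poly_Mapping.lookup m v) * (\<Prod>v\<in>?S. x v ^ Poly_Mapping.lookup n v)"
    by (simp add: lookup_add power_add prod.distrib)
  also have "\<dots> = mon_eval x m * mon_eval x n"
    using mon_eval_superset[of ?S m x] mon_eval_superset[of ?S n x] by simp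
  finally show ?thesis .
qed

lemma meval_superset:
  assumes "finite S" "Poly_Mapping.keys p \<subseteq> S"
  shows "meval x p = (\<Sum>m\<in>S. Poly_Mapping.lookup p m * mon_eval x m)"
  unfolding meval_def
  by (rule sum.mono_neutral_left) (use assms in \<open>auto simp: in_keys_iff\<close>)

lemma meval_0 [simp]: "meval x 0 = 0"
  by (simp add: meval_def)

lemma meval_single: "meval x (Poly_Mapping.single m c) = c * mon_eval x m"
  by (subst meval_superset[of "{m}"]) auto

lemma meval_mconst [simp]: "meval x (mconst c) = c"
  by (simp add: mconst_def meval_single)

lemma meval_1 [simp]: "meval x 1 = 1"
  using meval_mconst[of x 1] by (simp add: mconst_def)

lemma meval_mvar [simp]: "meval x (mvar v) = x v"
  by (simp add: mvar_def meval_single mon_eval_def)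

lemma meval_add [simp]: "meval x (p + q) = meval x p + meval x q"
proof -
  let ?S = "Poly_Mapping.keys p \<union> Poly_Mapping.keys q"
  have "meval x (p + q) = (\<Sum>m\<in>?S. Poly_Mapping.lookup (p + q) m * mon_eval x m)"
    by (rule meval_superset) (use keys_add[of p q] in auto)
  also have "\<dots> = (\<Sum>m\<in>?S. Poly_Mapping.lookup p m * mon_eval x m)
                   + (\<Sum>m\<in>?S. Poly_Mapping.lookup q m * mon_eval x m)"
    by (simp add: lookup_add algebra_simps sum.distrib)
  also have "\<dots> = meval x p + meval x q"
    using meval_superset[of ?S p x] meval_superset[of ?S q x] by simp
  finally show ?thesis .
qed

lemma meval_uminus [simp]: "meval x (- p) = - meval x p"
  using meval_add[of x p "- p"] by simp

lemma meval_diff [simp]: "meval x (p - q) = meval x p - meval x q"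
  using meval_add[of x p "- q"] by simp

lemma meval_sum [simp]: "meval x (sum f A) = (\<Sum>i\<in>A. meval x (f i))"
  by (induction A rule: infinite_finite_induct) auto

lemma mpoly_eq_sum_single:
  fixes p :: "'v mpoly"
  shows "p = (\<Sum>m\<in>Poly_Mapping.keys p. Poly_Mapping.single m (Poly_Mapping.lookup p m))"
  by (rule poly_mapping_eqI)
     (auto simp: lookup_sum lookup_single when_def in_keys_iff)

lemma meval_mult [simp]: "meval x (p * q) = meval x p * meval x q"
proof -
  let ?s = "\<lambda>p m. Poly_Mapping.single m (Poly_Mapping.lookup p m)"
  have "meval x (p * q) =
      meval x ((\<Sum>m\<in>Poly_Mapping.keys p. ?s p m) * (\<Sum>n\<in>Poly_Mapping.keys q. ?s q n))"
    using mpoly_eq_sum_single[of p] mpoly_eq_sum_single[of q] by simp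
  also have "\<dots> = meval x p * meval x q"
    by (simp add: sum_product mult_single meval_single mon_eval_add)
       (simp add: meval_def sum_product algebra_simps)
  finally show ?thesis .
qed

lemma meval_coeff_mult:
  "meval x (Polynomial.coeff (p * q) i) =
     (\<Sum>j\<le>i. meval x (Polynomial.coeff p j) * meval x (Polynomial.coeff q (i - j)))"
  by (simp add: Polynomial.coeff_mult)

lemma coeff_lag_poly: "Polynomial.coeff (lag_poly n c) i = (if i \<in> {1..n} then c i else 0)"
  by (simp add: lag_poly_def Polynomial.coeff_sum)

lemma meval_acl_poly:
  "meval x (acl_poly na nb nta ntb ta tb i) =
     acl na nb nta ntb (\<lambda>i. x (VA i)) (\<lambda>i. x (VB i)) ta tb i"
proof -
  have *: "meval x (Polynomial.coeff (1 + lag_poly n c) i) =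
      Polynomial.coeff (1 + lag_poly n (\<lambda>i. meval x (c i))) i" for n c i
    by (simp add: coeff_lag_poly Polynomial.coeff_1)
  have **: "meval x (Polynomial.coeff (lag_poly n c) i) =
      Polynomial.coeff (lag_poly n (\<lambda>i. meval x (c i))) i" for n c i
    by (simp add: coeff_lag_poly)
  show ?thesis
    unfolding acl_poly_def acl_def Polynomial.coeff_diff Polynomial.coeff_add[of "_ * _"]
      meval_diff meval_add meval_coeff_mult * **
    by (simp add: Polynomial.coeff_mult Polynomial.coeff_1)
qed

lemma Pbar_iff:
  "x \<in> Pbar na nb T \<epsilon>u \<epsilon>y uh yh \<longleftrightarrow>
     x \<in> arx_vars na nb T \<rightarrow>\<^sub>E UNIV \<and>
     (\<forall>t\<in>{1 - int nb..int T - 1}. \<epsilon>u - x (VU t) \<ge> 0 \<and> \<epsilon>u + x (VU t) \<ge> 0) \<and>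
     (\<forall>t\<in>{1 - int na..int T}. \<epsilon>y - x (VY t) \<ge> 0 \<and> \<epsilon>y + x (VY t) \<ge> 0) \<and>
     (\<forall>t\<in>{1..int T}.
        0 = (yh t + (\<Sum>i=1..na. x (VA i) * yh (t - int i)) - (\<Sum>i=1..nb. x (VB i) * uh (t - int i)))
            - (\<Sum>i=1..na. x (VA i) * x (VY (t - int i)))
            + (\<Sum>i=1..nb. x (VB i) * x (VU (t - int i))) - x (VY t))"
proof -
  have eq: "(0 = r) = (r = 0)" for r :: real by auto
  show ?thesis
    unfolding Pbar_def semialg_def Pbar_ineqs_def Pbar_eqs_def h_poly_def eq
    by (simp add: ball_Un ball_conj_distrib conj_ac)
qed

end

theory Submission
  imports Defs
begin

text \<open>
  A feasible point of the level-\<open>d\<close> program consists of polynomial inequalities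
  \<open>\<gamma> \<ge> \<Sum>\<^sub>i m\<^sub>i\<close> and \<open>m\<^sub>i \<ge> \<plusminus> a\<^sup>c\<^sup>l\<^sub>i\<close> with certificates of degree at most \<open>2d\<close>. Evaluating the
  certificates at a point of the consistency set shows that \<open>\<gamma>\<close> bounds the \<open>1\<close>-norm there, and a
  certificate of degree \<open>2d\<close> is also one of degree \<open>2(d + 1)\<close>. This gives the two monotonicity claims
  (\<open>gamma_star_le_gamma_sos\<close>, \<open>gamma_sos_antimono\<close>).

  For convergence, take a controller whose worst-case norm is at most \<open>\<gamma>\<close>, and \<open>\<epsilon> > 0\<close>. The functions
  \<open>\<bar>a\<^sup>c\<^sup>l\<^sub>i\<bar>\<close> of \<open>(a, b)\<close> need not be polynomial, but each \<open>a\<^sup>c\<^sup>l\<^sub>i\<close> is bounded on the consistency set, so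
  Weierstrass approximation of \<open>\<bar>s\<bar>\<close> on an interval, composed with \<open>a\<^sup>c\<^sup>l\<^sub>i\<close>, gives polynomials \<open>m\<^sub>i\<close> in
  \<open>(a, b)\<close> lying strictly above \<open>\<bar>a\<^sup>c\<^sup>l\<^sub>i\<bar>\<close> and so tight that \<open>\<gamma> + \<epsilon> > \<Sum>\<^sub>i m\<^sub>i\<close>
  (\<open>polynomial_majorant_of_abs\<close>). Now all the constraint polynomials are strictly positive on the
  consistency set, so Putinar's Positivstellensatz (\<open>putinar_positivstellensatz\<close>) certifies each of
  them; there are finitely many, hence one degree suffices and \<open>\<gamma>\<^sub>d \<le> \<gamma> + \<epsilon>\<close> from some \<open>d\<close> on
  (\<open>eventually_sos_feasible\<close>).

  The Positivstellensatz is proved algebraically, for a quadratic module \<open>M\<close> in a commutative real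
  algebra in which every element is bounded by a constant modulo \<open>M\<close>. If \<open>f\<close> is positive under
  every real character that is nonnegative on \<open>M\<close>, then \<open>f \<in> M\<close> (\<open>positive_on_characters\<close>). Indeed,
  adjoin \<open>- f\<close> to \<open>M\<close>. If the result were a proper module, Zorn's lemma would give a maximal proper one
  above it; such a module is total and so defines a Dedekind cut for every element, and the cut points
  form a character, nonnegative on \<open>M\<close> and at \<open>- f\<close>. Therefore \<open>- 1 = s - t f\<close> with \<open>s \<in> M\<close> and \<open>t\<close>
  a sum of squares, and the boundedness lets the factor \<open>t\<close> be removed from \<open>t f - 1 \<in> M\<close>
  (\<open>qm_divide_sqsums\<close>). The characters of a polynomial ring are the evaluations at points.
\<close>


section \<open>Quadratic modules and characters of real algebras\<close>

text \<open>
  The algebra is a subset of a ring, with the constants given by an embedding \<open>c\<close> of \<open>\<real>\<close>, because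
  polynomials in the variables \<open>V\<close> form a subset of a type that has further variables, and the
  constraints say nothing about those.
\<close>

locale real_subalgebra =
  fixes A :: "'a::comm_ring_1 set" and c :: "real \<Rightarrow> 'a"
  assumes c_1: "c 1 = 1"
    and c_add: "c (r + s) = c r + c s"
    and c_mult: "c (r * s) = c r * c s"
    and c_mem: "c r \<in> A"
    and add_mem: "x \<in> A \<Longrightarrow> y \<in> A \<Longrightarrow> x + y \<in> A"
    and mult_mem: "x \<in> A \<Longrightarrow> y \<in> A \<Longrightarrow> x * y \<in> A"
begin

lemma c_0: "c 0 = 0"
  using c_add[of 0 0] by simp

lemma c_minus: "c (- r) = - c r"
  using c_add[of r "- r"] by (simp add: c_0 add_eq_0_iff)

lemma c_diff: "c (r - s) = c r - c s"
  using c_add[of r "- s"] by (simp add: c_minus)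

lemma c_power2: "c (r\<^sup>2) = (c r)\<^sup>2"
  by (simp add: power2_eq_square c_mult)

lemma uminus_mem: "x \<in> A \<Longrightarrow> - x \<in> A"
  using mult_mem[of "c (- 1)" x] c_mem[of "- 1"] by (simp add: c_minus c_1)

lemma diff_mem: "x \<in> A \<Longrightarrow> y \<in> A \<Longrightarrow> x - y \<in> A"
  using add_mem[of x "- y"] uminus_mem[of y] by simp

lemma one_mem: "1 \<in> A"
  using c_mem[of 1] by (simp add: c_1)

lemma zero_mem: "0 \<in> A"
  using c_mem[of 0] by (simp add: c_0)

lemma power2_mem: "x \<in> A \<Longrightarrow> x\<^sup>2 \<in> A"
  by (simp add: power2_eq_square mult_mem)

inductive_set sqsums :: "'a set" where
  zero: "0 \<in> sqsums"
| step: "a \<in> A \<Longrightarrow> t \<in> sqsums \<Longrightarrow> a\<^sup>2 + t \<in> sqsums"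

lemma sqsums_mem: "t \<in> sqsums \<Longrightarrow> t \<in> A"
  by (induction rule: sqsums.induct) (auto intro: zero_mem add_mem power2_mem)

lemma sqsums_add: "t \<in> sqsums \<Longrightarrow> u \<in> sqsums \<Longrightarrow> t + u \<in> sqsums"
  by (induction rule: sqsums.induct) (auto simp: add.assoc intro: sqsums.step)

lemma power2_sqsums: "a \<in> A \<Longrightarrow> a\<^sup>2 \<in> sqsums"
  using sqsums.step[OF _ sqsums.zero, of a] by simp

lemma power2_mult_sqsums: "t \<in> sqsums \<Longrightarrow> a \<in> A \<Longrightarrow> a\<^sup>2 * t \<in> sqsums"
proof (induction rule: sqsums.induct)
  case zero
  then show ?case by (simp add: sqsums.zero)
next
  case (step b t)
  then have "(a * b)\<^sup>2 + a\<^sup>2 * t \<in> sqsums"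
    by (intro sqsums.step mult_mem) auto
  then show ?case by (simp add: power_mult_distrib distrib_left)
qed

definition quadratic_module :: "'a set \<Rightarrow> bool" where
  "quadratic_module M \<longleftrightarrow> M \<subseteq> A \<and> 1 \<in> M \<and> (\<forall>x\<in>M. \<forall>y\<in>M. x + y \<in> M)
     \<and> (\<forall>a\<in>A. \<forall>x\<in>M. a\<^sup>2 * x \<in> M)"

text \<open>\<open>c 1\<close> is an order unit for the cone \<open>M\<close>.\<close>

definition bounded_by_constants :: "'a set \<Rightarrow> bool" where
  "bounded_by_constants M \<longleftrightarrow> (\<forall>a\<in>A. \<exists>r. c r - a \<in> M)"

definition character :: "('a \<Rightarrow> real) \<Rightarrow> bool" where
  "character \<phi> \<longleftrightarrow> (\<forall>r. \<phi> (c r) = r) \<and> (\<forall>x\<in>A. \<forall>y\<in>A. \<phi> (x + y) = \<phi> x + \<phi> y)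
     \<and> (\<forall>x\<in>A. \<forall>y\<in>A. \<phi> (x * y) = \<phi> x * \<phi> y)"

context
  fixes M
  assumes M: "quadratic_module M"
begin

lemma qm_mem: "x \<in> M \<Longrightarrow> x \<in> A"
  and qm_1: "1 \<in> M"
  and qm_add: "x \<in> M \<Longrightarrow> y \<in> M \<Longrightarrow> x + y \<in> M"
  and qm_sq_mult: "a \<in> A \<Longrightarrow> x \<in> M \<Longrightarrow> a\<^sup>2 * x \<in> M"
  using M by (auto simp: quadratic_module_def)

lemma qm_sq: "a \<in> A \<Longrightarrow> a\<^sup>2 \<in> M"
  using qm_sq_mult[OF _ qm_1] by simp

lemma qm_sqsums_mult: "t \<in> sqsums \<Longrightarrow> x \<in> M \<Longrightarrow> t * x \<in> M"
proof (induction rule: sqsums.induct)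
  case zero
  then show ?case using qm_sq_mult[OF zero_mem] by simp
next
  case (step a t)
  then show ?case by (simp add: distrib_right qm_add qm_sq_mult)
qed

lemma qm_sqsums: "t \<in> sqsums \<Longrightarrow> t \<in> M"
  using qm_sqsums_mult[OF _ qm_1] by simp

lemma qm_scale: "0 \<le> r \<Longrightarrow> x \<in> M \<Longrightarrow> c r * x \<in> M"
  using qm_sq_mult[OF c_mem, of x "sqrt r"] by (simp flip: c_power2)

lemma qm_c: "0 \<le> r \<Longrightarrow> c r \<in> M"
  using qm_scale[OF _ qm_1] by simp

lemma qm_descale: "0 < r \<Longrightarrow> c r * x \<in> M \<Longrightarrow> x \<in> M"
  using qm_scale[of "inverse r" "c r * x"]
  by (simp flip: c_mult mult.assoc) (simp add: c_1)

lemma qm_c_proper: "- 1 \<notin> M \<Longrightarrow> c r \<in> M \<Longrightarrow> 0 \<le> r"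
  using qm_descale[of "- r" "- 1"] by (force simp: c_minus)

text \<open>
  Products of two elements of \<open>M\<close> need not lie in \<open>M\<close>, but this particular product does, because
  \<open>2r (r + a)(r - a) = (r + a)\<^sup>2 (r - a) + (r - a)\<^sup>2 (r + a)\<close>.
\<close>

lemma qm_diff_squares:
  assumes "0 < r" "a \<in> A" "c r - a \<in> M" "c r + a \<in> M"
  shows "c (r\<^sup>2) - a\<^sup>2 \<in> M"
proof -
  have "(c r + a)\<^sup>2 * (c r - a) + (c r - a)\<^sup>2 * (c r + a) \<in> M"
    using assms by (intro qm_add[of "_ * _"] qm_sq_mult add_mem diff_mem c_mem)
  also have "(c r + a)\<^sup>2 * (c r - a) + (c r - a)\<^sup>2 * (c r + a) = (c r + c r) * (c (r\<^sup>2) - a\<^sup>2)"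
    unfolding c_power2 by (simp add: power2_eq_square algebra_simps)
  also have "c r + c r = c (2 * r)"
    using c_add[of r r] by simp
  finally show ?thesis
    using qm_descale[of "2 * r"] assms by simp
qed

text \<open>
  The set \<open>M \<inter> - M\<close> is closed under multiplication by squares, and every element of \<open>A\<close> is a
  difference of two squares, \<open>x = ((x + 1) / 2)\<^sup>2 - ((x - 1) / 2)\<^sup>2\<close>; so it is an ideal.
\<close>

lemma qm_support_ideal:
  assumes "t \<in> M" "- t \<in> M" "x \<in> A"
  shows "t * x \<in> M"
proof -
  let ?h = "c (1 / 2)"
  have h: "?h * ?h * 4 = 1"
  proof -
    have "?h * ?h * 4 = (?h + ?h) * (?h + ?h)" by (simp add: algebra_simps)
    also have "?h + ?h = 1" using c_add[of "1 / 2" "1 / 2"] by (simp add: c_1)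
    finally show ?thesis by simp
  qed
  have "(?h * (x + 1))\<^sup>2 * t + (?h * (x - 1))\<^sup>2 * (- t) \<in> M"
    using assms by (intro qm_add qm_sq_mult mult_mem c_mem add_mem diff_mem one_mem)
  also have "(?h * (x + 1))\<^sup>2 * t + (?h * (x - 1))\<^sup>2 * (- t) = (?h * ?h * 4) * (t * x)"
    by (simp add: power2_eq_square algebra_simps)
  finally show ?thesis by (simp add: h)
qed

lemma quadratic_module_adjoin:
  assumes "a \<in> A"
  shows "quadratic_module {s + t * a | s t. s \<in> M \<and> t \<in> sqsums}" (is "quadratic_module ?N")
proof -
  have "?N \<subseteq> A"
    using assms by (auto intro!: add_mem mult_mem dest: qm_mem sqsums_mem)
  moreover have "1 \<in> ?N"
    by (rule CollectI, rule exI[of _ 1], rule exI[of _ 0]) (auto intro: qm_1 sqsums.zero)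
  moreover have "x + y \<in> ?N" if "x \<in> ?N" "y \<in> ?N" for x y
  proof -
    from that obtain s t s' t' where "x = s + t * a" "y = s' + t' * a"
      and "s \<in> M" "t \<in> sqsums" "s' \<in> M" "t' \<in> sqsums" by blast
    moreover from this have "x + y = (s + s') + (t + t') * a" by (simp add: algebra_simps)
    ultimately show ?thesis by (blast intro: qm_add sqsums_add)
  qed
  moreover have "b\<^sup>2 * x \<in> ?N" if "b \<in> A" "x \<in> ?N" for b x
  proof -
    from that obtain s t where "x = s + t * a" "s \<in> M" "t \<in> sqsums" by blast
    moreover from this have "b\<^sup>2 * x = b\<^sup>2 * s + (b\<^sup>2 * t) * a" by (simp add: algebra_simps)
    ultimately show ?thesis
      using that by (blast intro: qm_sq_mult power2_mult_sqsums)
  qed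
  ultimately show ?thesis unfolding quadratic_module_def by blast
qed

lemma subset_adjoin: "M \<subseteq> {s + t * a | s t. s \<in> M \<and> t \<in> sqsums}"
  by (rule subsetI, rule CollectI, rule exI, rule exI[of _ 0]) (auto intro: sqsums.zero)

lemma mem_adjoin: "a \<in> {s + t * a | s t. s \<in> M \<and> t \<in> sqsums}"
proof -
  have "a = 0 + 1 * a" "0 \<in> M" "1 \<in> sqsums"
    using qm_c[of 0] power2_sqsums[OF one_mem] by (auto simp: c_0)
  then show ?thesis by blast
qed

lemma exists_maximal_quadratic_module:
  assumes "- 1 \<notin> M"
  shows "\<exists>S. M \<subseteq> S \<and> quadratic_module S \<and> - 1 \<notin> S
    \<and> (\<forall>N. quadratic_module N \<longrightarrow> S \<subseteq> N \<longrightarrow> - 1 \<notin> N \<longrightarrow> N = S)"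
proof -
  let ?F = "{S. M \<subseteq> S \<and> quadratic_module S \<and> - 1 \<notin> S}"
  have "\<exists>S\<in>?F. \<forall>X\<in>?F. S \<subseteq> X \<longrightarrow> X = S"
  proof (rule subset_Zorn_nonempty)
    show "?F \<noteq> {}" using assms M by blast
  next
    fix \<C> assume \<C>: "\<C> \<noteq> {}" "subset.chain ?F \<C>"
    then have F: "X \<in> ?F" if "X \<in> \<C>" for X
      using that by (auto simp: subset_chain_def)
    have "x + y \<in> \<Union>\<C>" if xy: "x \<in> \<Union>\<C>" "y \<in> \<Union>\<C>" for x y
    proof -
      from xy obtain X Y where XY: "X \<in> \<C>" "x \<in> X" "Y \<in> \<C>" "y \<in> Y" by auto
      moreover from XY \<C>(2) have "X \<subseteq> Y \<or> Y \<subseteq> X" by (simp add: subset_chain_def)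
      ultimately obtain Z where "Z \<in> \<C>" "x \<in> Z" "y \<in> Z" by blast
      moreover from this F[of Z] have "x + y \<in> Z" by (simp add: quadratic_module_def)
      ultimately show ?thesis by blast
    qed
    moreover have "a\<^sup>2 * x \<in> \<Union>\<C>" if ax: "a \<in> A" "x \<in> \<Union>\<C>" for a x
    proof -
      from ax obtain X where "X \<in> \<C>" "x \<in> X" by auto
      moreover from this ax F[of X] have "a\<^sup>2 * x \<in> X" by (simp add: quadratic_module_def)
      ultimately show ?thesis by blast
    qed
    moreover have "1 \<in> \<Union>\<C>" "\<Union>\<C> \<subseteq> A"
      using F \<C>(1) unfolding quadratic_module_def by blast+
    ultimately have "quadratic_module (\<Union>\<C>)"
      by (simp add: quadratic_module_def)
    then show "\<Union>\<C> \<in> ?F" using F \<C>(1) by blast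
  qed
  then obtain S where S: "S \<in> ?F" and max: "\<forall>X\<in>?F. S \<subseteq> X \<longrightarrow> X = S" by (rule bexE)
  have "N = S" if "quadratic_module N" "S \<subseteq> N" "- 1 \<notin> N" for N
  proof -
    have "N \<in> ?F" using S that by auto
    with max that(2) show ?thesis by simp
  qed
  with S show ?thesis by auto
qed

text \<open>
  If neither \<open>a\<close> nor \<open>- a\<close> lies in the maximal proper module \<open>M\<close>, then \<open>- 1 = s\<^sub>1 + t\<^sub>1 a\<close> and
  \<open>- 1 = s\<^sub>2 - t\<^sub>2 a\<close>. Eliminating \<open>a\<close> puts \<open>t\<^sub>1\<close> into the support ideal, hence also \<open>t\<^sub>1 a\<close>, and the first
  equation then gives \<open>- 1 \<in> M\<close>.
\<close>

lemma maximal_quadratic_module_total: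
  assumes "- 1 \<notin> M"
    and max: "\<forall>N. quadratic_module N \<longrightarrow> M \<subseteq> N \<longrightarrow> - 1 \<notin> N \<longrightarrow> N = M"
    and a: "a \<in> A"
  shows "a \<in> M \<or> - a \<in> M"
proof (rule ccontr)
  assume *: "\<not> (a \<in> M \<or> - a \<in> M)"
  have adj: "\<exists>s\<in>M. \<exists>t\<in>sqsums. - 1 = s + t * b" if "b \<in> A" "b \<notin> M" for b
  proof -
    have "- 1 \<in> {s + t * b | s t. s \<in> M \<and> t \<in> sqsums}"
      using max[rule_format, OF quadratic_module_adjoin[OF that(1)] subset_adjoin] mem_adjoin[of b] that(2)
      by blast
    then show ?thesis by blast
  qed
  from adj[of a] * a obtain s1 t1 where 1: "- 1 = s1 + t1 * a" "s1 \<in> M" "t1 \<in> sqsums" by blast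
  from adj[of "- a"] * a obtain s2 t2 where 2: "- 1 = s2 + t2 * - a" "s2 \<in> M" "t2 \<in> sqsums"
    by (blast intro: uminus_mem)
  have e1: "t1 * a = - 1 - s1"
    unfolding 1(1) by simp
  have "t2 * a = s2 - (s2 + t2 * - a)" by simp
  then have e2: "t2 * a = 1 + s2"
    unfolding 2(1)[symmetric] by simp
  have "- t1 = - (t1 * (1 + s2)) + t1 * s2" by (simp add: distrib_left)
  also have "t1 * (1 + s2) = t2 * (- 1 - s1)"
    unfolding e1[symmetric] e2[symmetric] by (simp add: mult.left_commute)
  also have "- (t2 * (- 1 - s1)) + t1 * s2 = t2 + t2 * s1 + t1 * s2"
    by (simp add: algebra_simps)
  finally have "- t1 = t2 + t2 * s1 + t1 * s2" .
  then have "- t1 \<in> M"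
    using 1 2 by (simp add: qm_add qm_sqsums qm_sqsums_mult)
  with 1 have "t1 * a \<in> M"
    by (intro qm_support_ideal a) (auto intro: qm_sqsums)
  with 1 have "- 1 \<in> M" by (simp add: qm_add)
  with assms(1) show False ..
qed

text \<open>
  A total proper module bounded by constants cuts \<open>\<real>\<close> at each \<open>a \<in> A\<close>: below the cut \<open>a - r \<in> M\<close>,
  above it \<open>r - a \<in> M\<close>. The cut point is the value of the character at \<open>a\<close>.
\<close>

lemma total_quadratic_module_cut:
  assumes "- 1 \<notin> M" and bd: "bounded_by_constants M" and tot: "\<And>a. a \<in> A \<Longrightarrow> a \<in> M \<or> - a \<in> M"
    and a: "a \<in> A"
  shows "\<exists>u. (\<forall>r<u. a - c r \<in> M) \<and> (\<forall>r>u. c r - a \<in> M)"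
proof -
  let ?L = "{r. a - c r \<in> M}"
  from bd a obtain N where N: "c N - a \<in> M"
    by (auto simp: bounded_by_constants_def)
  from bd a obtain N' where N': "c N' - (- a) \<in> M"
    unfolding bounded_by_constants_def using uminus_mem by blast
  have "- N' \<in> ?L" using N' by (simp add: c_minus add.commute)
  then have ne: "?L \<noteq> {}" by blast
  have le: "r \<le> N" if "r \<in> ?L" for r
  proof -
    have "(c N - a) + (a - c r) \<in> M" using that N by (intro qm_add) auto
    then have "c (N - r) \<in> M" by (simp add: c_diff)
    then show ?thesis using qm_c_proper[OF assms(1)] by fastforce
  qed
  have bdd: "bdd_above ?L" using le by (auto intro!: bdd_aboveI)
  show ?thesis
  proof (intro exI[of _ "Sup ?L"] conjI allI impI)
    fix r assume "r < Sup ?L"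
    then obtain s where s: "s \<in> ?L" "r < s" using less_cSup_iff[OF ne bdd] by blast
    then have "(a - c s) + c (s - r) \<in> M" by (intro qm_add qm_c) auto
    then show "a - c r \<in> M" by (simp add: c_diff)
  next
    fix r assume "r > Sup ?L"
    then have "a - c r \<notin> M" using cSup_upper[OF _ bdd, of r] by fastforce
    moreover have "a - c r \<in> A" using a by (intro diff_mem c_mem)
    ultimately show "c r - a \<in> M" using tot by fastforce
  qed
qed

text \<open>
  The cut points depend linearly on \<open>a\<close>. For multiplicativity it is enough to treat squares, and
  after subtracting a constant, the square of an \<open>a\<close> with cut point 0: then \<open>r \<plusminus> a \<in> M\<close> for all
  \<open>r > 0\<close>, hence \<open>r\<^sup>2 - a\<^sup>2 \<in> M\<close>, while \<open>a\<^sup>2 \<in> M\<close>.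
\<close>

lemma total_quadratic_module_character:
  assumes "- 1 \<notin> M" and bd: "bounded_by_constants M" and tot: "\<And>a. a \<in> A \<Longrightarrow> a \<in> M \<or> - a \<in> M"
  shows "\<exists>\<phi>. character \<phi> \<and> (\<forall>x\<in>M. 0 \<le> \<phi> x)"
proof -
  obtain \<phi> where "\<forall>a\<in>A. (\<forall>r<\<phi> a. a - c r \<in> M) \<and> (\<forall>r>\<phi> a. c r - a \<in> M)"
    using bchoice[of A "\<lambda>a u. (\<forall>r<u. a - c r \<in> M) \<and> (\<forall>r>u. c r - a \<in> M)"]
      total_quadratic_module_cut[OF assms] by blast
  then have below: "\<And>a r. a \<in> A \<Longrightarrow> r < \<phi> a \<Longrightarrow> a - c r \<in> M"
    and above: "\<And>a r. a \<in> A \<Longrightarrow> \<phi> a < r \<Longrightarrow> c r - a \<in> M" by auto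
  \<comment> \<open>A lower bound never exceeds an upper bound, so each cut has just one cut point.\<close>
  have sep: "r \<le> s" if "a - c r \<in> M" "c s - a \<in> M" for a r s
  proof -
    have "c (s - r) \<in> M" using qm_add[OF that] by (simp add: c_diff)
    then show ?thesis using qm_c_proper[OF assms(1)] by fastforce
  qed
  have le: "\<phi> a \<le> u" if "a \<in> A" "\<And>r. u < r \<Longrightarrow> c r - a \<in> M" for a u
  proof (rule dense_le)
    fix r assume "r < \<phi> a"
    with that(1) have "a - c r \<in> M" by (rule below)
    with sep that(2) show "r \<le> u" by (blast intro: dense_ge)
  qed
  have ge: "u \<le> \<phi> a" if "a \<in> A" "\<And>r. r < u \<Longrightarrow> a - c r \<in> M" for a u
  proof (rule dense_ge)
    fix r assume "\<phi> a < r"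
    with that(1) have "c r - a \<in> M" by (rule above)
    with sep that(2) show "u \<le> r" by (blast intro: dense_le)
  qed
  have const: "\<phi> (c r) = r" for r
  proof (rule antisym)
    show "\<phi> (c r) \<le> r" by (rule le) (auto simp flip: c_diff intro: c_mem qm_c)
    show "r \<le> \<phi> (c r)" by (rule ge) (auto simp flip: c_diff intro: c_mem qm_c)
  qed
  have add: "\<phi> (a + b) = \<phi> a + \<phi> b" if ab: "a \<in> A" "b \<in> A" for a b
  proof (rule antisym)
    show "\<phi> (a + b) \<le> \<phi> a + \<phi> b"
    proof (rule le)
      fix r assume r: "\<phi> a + \<phi> b < r"
      define e where "e = (r - \<phi> a - \<phi> b) / 2"
      have "(c (\<phi> a + e) - a) + (c (\<phi> b + e) - b) \<in> M"
        using r ab by (intro qm_add above) (auto simp: e_def)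
      also have "(c (\<phi> a + e) - a) + (c (\<phi> b + e) - b) = c ((\<phi> a + e) + (\<phi> b + e)) - (a + b)"
        unfolding c_add by (simp add: algebra_simps)
      also have "(\<phi> a + e) + (\<phi> b + e) = r" by (simp add: e_def field_simps)
      finally show "c r - (a + b) \<in> M" .
    qed (use ab in \<open>rule add_mem\<close>)
    show "\<phi> a + \<phi> b \<le> \<phi> (a + b)"
    proof (rule ge)
      fix r assume r: "r < \<phi> a + \<phi> b"
      define e where "e = (\<phi> a + \<phi> b - r) / 2"
      have "(a - c (\<phi> a - e)) + (b - c (\<phi> b - e)) \<in> M"
        using r ab by (intro qm_add below) (auto simp: e_def)
      also have "(a - c (\<phi> a - e)) + (b - c (\<phi> b - e)) = (a + b) - c ((\<phi> a - e) + (\<phi> b - e))"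
        unfolding c_add by (simp add: algebra_simps)
      also have "(\<phi> a - e) + (\<phi> b - e) = r" by (simp add: e_def field_simps)
      finally show "(a + b) - c r \<in> M" .
    qed (use ab in \<open>rule add_mem\<close>)
  qed
  have minus: "\<phi> (- a) = - \<phi> a" if "a \<in> A" for a
    using add[OF that uminus_mem[OF that]] const[of 0] by (simp add: c_0)
  have nonneg: "0 \<le> \<phi> x" if "x \<in> M" for x
  proof (rule ge)
    fix r :: real assume "r < 0"
    then have "x + c (- r) \<in> M" using that by (intro qm_add qm_c) auto
    then show "x - c r \<in> M" by (simp add: c_minus)
  qed (use that in \<open>rule qm_mem\<close>)
  have sq0: "\<phi> (a\<^sup>2) = 0" if a: "a \<in> A" "\<phi> a = 0" for a
  proof (rule antisym)
    show "\<phi> (a\<^sup>2) \<le> 0"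
    proof (rule le)
      fix r :: real assume r: "0 < r"
      have "c (sqrt r) - a \<in> M" "c (sqrt r) + a \<in> M"
        using above[of a "sqrt r"] below[of a "- sqrt r"] a r
        by (auto simp: c_minus add.commute)
      then show "c r - a\<^sup>2 \<in> M"
        using qm_diff_squares[of "sqrt r" a] a r by simp
    qed (use a in \<open>intro power2_mem\<close>)
    show "0 \<le> \<phi> (a\<^sup>2)" using a by (intro nonneg qm_sq)
  qed
  have scale_le: "\<phi> (c r * x) \<le> 0" if x: "x \<in> A" "\<phi> x = 0" and r: "0 \<le> r" for x r
  proof (rule le)
    fix u :: real assume u: "0 < u"
    define v where "v = u / (r + 1)"
    have "0 < v" "r * v \<le> u" using u r by (auto simp: v_def field_simps)
    then have "c r * (c v - x) + c (u - r * v) \<in> M"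
      using x r by (intro qm_add qm_scale qm_c above) auto
    then show "c u - c r * x \<in> M"
      by (simp add: c_diff c_mult right_diff_distrib)
  qed (use x in \<open>intro mult_mem c_mem\<close>)
  have scale: "\<phi> (c r * x) = 0" if x: "x \<in> A" "\<phi> x = 0" for x r
  proof -
    have "\<phi> (c \<bar>r\<bar> * x) \<le> 0" "\<phi> (c \<bar>r\<bar> * - x) \<le> 0"
      using x minus[of x] scale_le[of x "\<bar>r\<bar>"] scale_le[of "- x" "\<bar>r\<bar>"]
      by (simp_all add: uminus_mem)
    then have "\<phi> (c \<bar>r\<bar> * x) = 0"
      using minus[of "c \<bar>r\<bar> * x"] x by (simp add: mult_mem c_mem)
    then show ?thesis
      using minus[of "c r * x"] x by (cases "0 \<le> r") (simp_all add: c_minus mult_mem c_mem)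
  qed
  have sq: "\<phi> (a\<^sup>2) = (\<phi> a)\<^sup>2" if a: "a \<in> A" for a
  proof -
    let ?u = "\<phi> a"
    define b where "b = a + c (- ?u)"
    have b: "b \<in> A" "\<phi> b = 0"
      using a add[OF a c_mem] const by (auto simp: b_def intro: add_mem c_mem)
    have "a\<^sup>2 = b\<^sup>2 + (c (2 * ?u) * b + c (?u\<^sup>2))"
      using c_add[of ?u ?u] by (simp add: b_def c_minus c_mult[of ?u ?u] power2_eq_square algebra_simps)
    then show ?thesis
      using b by (simp add: add add_mem mult_mem c_mem power2_mem const scale sq0)
  qed
  have mult: "\<phi> (a * b) = \<phi> a * \<phi> b" if ab: "a \<in> A" "b \<in> A" for a b
  proof -
    have "(a + b)\<^sup>2 = a\<^sup>2 + (b\<^sup>2 + (a * b + a * b))"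
      by (simp add: power2_eq_square algebra_simps)
    then have "\<phi> ((a + b)\<^sup>2) = \<phi> (a\<^sup>2) + (\<phi> (b\<^sup>2) + (\<phi> (a * b) + \<phi> (a * b)))"
      using ab by (simp only: add add_mem mult_mem power2_mem)
    moreover have "\<phi> ((a + b)\<^sup>2) = (\<phi> a + \<phi> b)\<^sup>2"
      using ab by (simp only: sq add add_mem)
    ultimately have "(\<phi> a + \<phi> b)\<^sup>2 = (\<phi> a)\<^sup>2 + ((\<phi> b)\<^sup>2 + (\<phi> (a * b) + \<phi> (a * b)))"
      using ab by (simp only: sq)
    then show ?thesis by (simp add: power2_sum)
  qed
  have "character \<phi>"
    unfolding character_def using const add mult by simp
  with nonneg show ?thesis by blast
qed

text \<open>
  With \<open>k > 0\<close> chosen such that \<open>2k - s\<close> and \<open>2k - 1 - s\<^sup>2 f\<close> lie in \<open>M\<close>, the identity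
  \<open>(k - s)\<^sup>2 (f + r) + 2k (s f - 1) + r s (2k - s) + (2k - 1 - s\<^sup>2 f) = k\<^sup>2 (f + r) - 1\<close>
  shows that \<open>f + r \<in> M\<close> implies \<open>f + r - 1 / k\<^sup>2 \<in> M\<close>, for every \<open>r \<ge> 0\<close>. As \<open>k\<close> does not depend on \<open>r\<close>,
  finitely many such steps remove \<open>r\<close>.
\<close>

lemma qm_divide_sqsums:
  assumes bd: "bounded_by_constants M" and f: "f \<in> A" and s: "s \<in> sqsums" and sf: "s * f - 1 \<in> M"
  shows "f \<in> M"
proof -
  have sA: "s \<in> A" using s by (rule sqsums_mem)
  have bound: "\<exists>r>0. c r - x \<in> M" if "x \<in> A" for x
  proof -
    from that bd obtain r where "c r - x \<in> M" by (auto simp: bounded_by_constants_def)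
    then have "(c r - x) + c (\<bar>r\<bar> + 1 - r) \<in> M" by (intro qm_add qm_c) auto
    then have "c (\<bar>r\<bar> + 1) - x \<in> M" by (simp add: c_diff)
    then show ?thesis by (intro exI[of _ "\<bar>r\<bar> + 1"]) auto
  qed
  obtain r1 where r1: "0 < r1" "c r1 - s \<in> M" using bound[OF sA] by blast
  obtain r2 where r2: "0 < r2" "c r2 - (1 + s\<^sup>2 * f) \<in> M"
    using bound[of "1 + s\<^sup>2 * f"] sA f by (blast intro: add_mem one_mem mult_mem power2_mem)
  obtain r0 where r0: "0 < r0" "c r0 - (- f) \<in> M" using bound[OF uminus_mem[OF f]] by blast
  \<comment> \<open>Enlarging a bound is harmless, so \<open>2k\<close> can serve for both polynomials at once.\<close>
  define k where "k = (r1 + r2) / 2"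
  have k: "0 < k" using r1 r2 by (simp add: k_def)
  have ck: "c (2 * k) = c k + c k" using c_add[of k k] by simp
  have 2: "2 * k = r1 + r2" by (simp add: k_def)
  have k1: "c (2 * k) - s \<in> M"
    using qm_add[OF r1(2) qm_c[of r2]] r2 unfolding 2 c_add by (simp add: algebra_simps)
  have k2: "c (2 * k) - (1 + s\<^sup>2 * f) \<in> M"
    using qm_add[OF r2(2) qm_c[of r1]] r1 unfolding 2 c_add by (simp add: algebra_simps)
  have step: "f + c (r - 1 / k\<^sup>2) \<in> M" if r: "0 \<le> r" "f + c r \<in> M" for r
  proof -
    have "(c k - s)\<^sup>2 * (f + c r) + c (2 * k) * (s * f - 1) + c r * (s * (c (2 * k) - s))
        + (c (2 * k) - (1 + s\<^sup>2 * f)) \<in> M"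
    proof (intro qm_add)
      show "(c k - s)\<^sup>2 * (f + c r) \<in> M" using r sA by (intro qm_sq_mult diff_mem c_mem)
      show "c (2 * k) * (s * f - 1) \<in> M" using k sf by (intro qm_scale) auto
      show "c r * (s * (c (2 * k) - s)) \<in> M" using r k1 s by (intro qm_scale qm_sqsums_mult)
    qed (rule k2)
    also have "(c k - s)\<^sup>2 * (f + c r) + c (2 * k) * (s * f - 1) + c r * (s * (c (2 * k) - s))
        + (c (2 * k) - (1 + s\<^sup>2 * f)) = c (k\<^sup>2) * f + (c (k\<^sup>2) * c r - 1)"
      unfolding c_power2 ck by (simp add: power2_eq_square algebra_simps)
    also have "c (k\<^sup>2) * c r - 1 = c (k\<^sup>2 * (r - 1 / k\<^sup>2))"
      using k by (simp add: right_diff_distrib c_diff c_mult c_1 flip: c_mult)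
    also have "c (k\<^sup>2) * f + c (k\<^sup>2 * (r - 1 / k\<^sup>2)) = c (k\<^sup>2) * (f + c (r - 1 / k\<^sup>2))"
      by (simp only: c_mult distrib_left)
    finally show ?thesis using qm_descale[of "k\<^sup>2"] k by simp
  qed
  \<comment> \<open>The step needs a nonnegative constant, hence the truncation at 0.\<close>
  have steps: "f + c (max 0 (r0 - real n / k\<^sup>2)) \<in> M" for n
  proof (induction n)
    case 0
    then show ?case using r0 by (simp add: add.commute)
  next
    case (Suc n)
    let ?r = "max 0 (r0 - real n / k\<^sup>2)" and ?r' = "max 0 (r0 - real (Suc n) / k\<^sup>2)"
    have "0 \<le> ?r' - (?r - 1 / k\<^sup>2)"
      using k by (auto simp: add_divide_distrib max_def not_le intro: add_strict_increasing)
    then have "f + c (?r - 1 / k\<^sup>2) + c (?r' - (?r - 1 / k\<^sup>2)) \<in> M"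
      using step[OF _ Suc] by (intro qm_add[of "f + _"] qm_c) auto
    then show ?case by (simp add: c_diff)
  qed
  obtain n where "r0 * k\<^sup>2 < real n" using reals_Archimedean2 by blast
  then have "r0 - real n / k\<^sup>2 \<le> 0" using k by (simp add: field_simps)
  then show ?thesis using steps[of n] by (simp add: c_0 max_absorb1)
qed

end

text \<open>
  If \<open>- 1\<close> were not of the form \<open>s - t f\<close> with \<open>s \<in> M\<close> and \<open>t\<close> a sum of squares, then a maximal
  proper module above \<open>M\<close> and \<open>- f\<close> would give a character that is nonnegative on \<open>M\<close> and at \<open>- f\<close>.
  So \<open>t f - 1 \<in> M\<close> for some \<open>t\<close>, and \<open>t\<close> can be cancelled.
\<close>

theorem positive_on_characters:
  assumes M: "quadratic_module M" and bd: "bounded_by_constants M" and f: "f \<in> A"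
    and pos: "\<And>\<phi>. character \<phi> \<Longrightarrow> (\<forall>x\<in>M. 0 \<le> \<phi> x) \<Longrightarrow> 0 < \<phi> f"
  shows "f \<in> M"
proof -
  define N where "N = {s + t * - f | s t. s \<in> M \<and> t \<in> sqsums}"
  have N: "quadratic_module N" "M \<subseteq> N" "- f \<in> N"
    unfolding N_def
    by (rule quadratic_module_adjoin[OF M uminus_mem[OF f]] subset_adjoin[OF M] mem_adjoin[OF M])+
  have "- 1 \<in> N"
  proof (rule ccontr)
    assume "- 1 \<notin> N"
    from exists_maximal_quadratic_module[OF N(1) this]
    obtain S where S: "N \<subseteq> S" "quadratic_module S" "- 1 \<notin> S"
      and max: "\<forall>N. quadratic_module N \<longrightarrow> S \<subseteq> N \<longrightarrow> - 1 \<notin> N \<longrightarrow> N = S" by blast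
    have MS: "M \<subseteq> S" and fS: "- f \<in> S" using N S(1) by auto
    have "bounded_by_constants S"
      using bd MS unfolding bounded_by_constants_def by fast
    from total_quadratic_module_character[OF S(2,3) this
        maximal_quadratic_module_total[OF S(2,3) max]]
    obtain \<phi> where \<phi>: "character \<phi>" "\<forall>x\<in>S. 0 \<le> \<phi> x" by blast
    have "0 \<le> \<phi> (- f)" using \<phi>(2) fS by (rule bspec)
    moreover have "0 < \<phi> f" using \<phi> MS by (intro pos) auto
    moreover have "\<phi> (- f + f) = \<phi> (- f) + \<phi> f" "\<phi> (c 0) = 0"
      using \<phi>(1) f uminus_mem[OF f] unfolding character_def by blast+
    ultimately show False by (simp add: c_0)
  qed
  then obtain s t where st: "- 1 = s + t * - f" "s \<in> M" "t \<in> sqsums" unfolding N_def by blast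
  have "t * f - 1 = t * f + (s + t * - f)" unfolding st(1)[symmetric] by simp
  then have "t * f - 1 = s" by simp
  with st show ?thesis using qm_divide_sqsums[OF M bd f, of t] by simp
qed

text \<open>
  These elements form a ring, so it is enough to find the generators of an algebra among them.
\<close>

definition bounded_elements :: "'a set \<Rightarrow> 'a set" where
  "bounded_elements M = {x \<in> A. \<exists>r>0. c r - x \<in> M \<and> c r + x \<in> M}"

context
  fixes M
  assumes M: "quadratic_module M"
begin

lemma bounded_elementsI:
  assumes "x \<in> A" "c r - x \<in> M" "c r + x \<in> M"
  shows "x \<in> bounded_elements M"
proof -
  have "(c r - x) + c (\<bar>r\<bar> + 1 - r) \<in> M" "(c r + x) + c (\<bar>r\<bar> + 1 - r) \<in> M"
    using assms by (auto intro!: qm_add[OF M] qm_c[OF M])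
  then have "c (\<bar>r\<bar> + 1) - x \<in> M" "c (\<bar>r\<bar> + 1) + x \<in> M"
    by (simp_all add: c_diff add.commute)
  moreover have "0 < \<bar>r\<bar> + 1" by simp
  ultimately show ?thesis using assms(1) unfolding bounded_elements_def by blast
qed

lemma c_bounded: "c r \<in> bounded_elements M"
proof (rule bounded_elementsI)
  show "c \<bar>r\<bar> - c r \<in> M" "c \<bar>r\<bar> + c r \<in> M"
    unfolding c_diff[symmetric] c_add[symmetric] by (auto intro: qm_c[OF M])
qed (rule c_mem)

lemma uminus_bounded: "x \<in> bounded_elements M \<Longrightarrow> - x \<in> bounded_elements M"
  unfolding bounded_elements_def by (auto intro: uminus_mem)

lemma add_bounded:
  assumes "x \<in> bounded_elements M" "y \<in> bounded_elements M"
  shows "x + y \<in> bounded_elements M"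
proof -
  from assms obtain r s where xy: "x \<in> A" "y \<in> A"
    and r: "c r - x \<in> M" "c r + x \<in> M" and s: "c s - y \<in> M" "c s + y \<in> M"
    unfolding bounded_elements_def by auto
  have "(c r - x) + (c s - y) \<in> M" "(c r + x) + (c s + y) \<in> M"
    using r s by (auto intro: qm_add[OF M])
  then have "c (r + s) - (x + y) \<in> M" "c (r + s) + (x + y) \<in> M"
    by (simp_all add: c_add algebra_simps)
  then show ?thesis using xy by (intro bounded_elementsI add_mem)
qed

lemma power2_bounded:
  assumes "x \<in> bounded_elements M"
  shows "x\<^sup>2 \<in> bounded_elements M"
proof -
  from assms obtain r where x: "x \<in> A" and r: "0 < r" "c r - x \<in> M" "c r + x \<in> M"
    unfolding bounded_elements_def by auto
  have "c (r\<^sup>2) - x\<^sup>2 \<in> M" using qm_diff_squares[OF M r(1) x r(2,3)] .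
  moreover have "c (r\<^sup>2) + x\<^sup>2 \<in> M" using x by (intro qm_add[OF M] qm_c[OF M] qm_sq[OF M]) auto
  ultimately show ?thesis using x by (intro bounded_elementsI power2_mem)
qed

text \<open>By polarization, \<open>4xy = (x + y)\<^sup>2 - (x - y)\<^sup>2\<close>, products reduce to squares.\<close>

lemma mult_bounded:
  assumes "x \<in> bounded_elements M" "y \<in> bounded_elements M"
  shows "x * y \<in> bounded_elements M"
proof -
  have xy: "x \<in> A" "y \<in> A" using assms unfolding bounded_elements_def by auto
  have "(x + y)\<^sup>2 + - ((x + - y)\<^sup>2) \<in> bounded_elements M"
    using assms by (intro add_bounded power2_bounded uminus_bounded)
  also have "(x + y)\<^sup>2 + - ((x + - y)\<^sup>2) = c 4 * (x * y)"
  proof -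
    have "c 4 = c 1 + c 1 + c 1 + c 1" unfolding c_add[symmetric] by simp
    then show ?thesis by (simp add: c_1 power2_eq_square algebra_simps)
  qed
  finally obtain r where r: "c r - c 4 * (x * y) \<in> M" "c r + c 4 * (x * y) \<in> M"
    unfolding bounded_elements_def by auto
  have "c 4 * (c (r / 4) - x * y) \<in> M" "c 4 * (c (r / 4) + x * y) \<in> M"
    using r by (simp_all add: right_diff_distrib distrib_left flip: c_mult)
  then have "c (r / 4) - x * y \<in> M" "c (r / 4) + x * y \<in> M"
    using qm_descale[OF M, of 4] by auto
  then show ?thesis using xy by (intro bounded_elementsI mult_mem)
qed

text \<open>\<open>r + 1/4 \<plusminus> x = (r - x\<^sup>2) + (x \<plusminus> 1/2)\<^sup>2\<close>.\<close>

lemma bounded_if_square_bounded: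
  assumes x: "x \<in> A" and r: "c r - x\<^sup>2 \<in> M"
  shows "x \<in> bounded_elements M"
proof -
  let ?h = "c (1 / 2)"
  have h: "?h + ?h = 1" using c_add[of "1 / 2" "1 / 2"] by (simp add: c_1)
  have "(c r - x\<^sup>2) + (x - ?h)\<^sup>2 \<in> M" "(c r - x\<^sup>2) + (x + ?h)\<^sup>2 \<in> M"
    using x r by (auto intro!: qm_add[OF M] qm_sq[OF M] diff_mem add_mem c_mem)
  moreover have "(c r - x\<^sup>2) + (x - ?h)\<^sup>2 = c r + ?h\<^sup>2 - (?h + ?h) * x"
    "(c r - x\<^sup>2) + (x + ?h)\<^sup>2 = c r + ?h\<^sup>2 + (?h + ?h) * x"
    by (simp_all add: power2_eq_square algebra_simps)
  ultimately have "c (r + (1 / 2)\<^sup>2) - x \<in> M" "c (r + (1 / 2)\<^sup>2) + x \<in> M"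
    by (simp_all only: h c_add c_power2 mult_1)
  then show ?thesis using x by (intro bounded_elementsI)
qed

end

end

section \<open>Polynomial rings as real algebras\<close>

lemma mconst_add: "mconst (r + s) = mconst r + mconst s"
  by (simp add: mconst_def single_add)

lemma mconst_mult: "mconst (r * s) = mconst r * mconst s"
  by (simp add: mconst_def mult_single)

lemma mconst_1: "mconst 1 = 1"
  by (simp add: mconst_def)

lemma mconst_polys: "mconst r \<in> polys V"
  by (simp add: mconst_def polys_def)

lemma mvar_polys: "v \<in> V \<Longrightarrow> mvar v \<in> polys V"
  by (simp add: mvar_def polys_def)

lemma add_polys: "p \<in> polys V \<Longrightarrow> q \<in> polys V \<Longrightarrow> p + q \<in> polys V"
  using keys_add[of p q] unfolding polys_def by blast

lemma mult_polys:
  assumes "p \<in> polys V" "q \<in> polys V"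
  shows "p * q \<in> polys V"
proof -
  have "Poly_Mapping.keys m \<subseteq> V" if "m \<in> Poly_Mapping.keys (p * q)" for m
  proof -
    from that keys_mult[of p q] obtain a b where
      "m = a + b" "a \<in> Poly_Mapping.keys p" "b \<in> Poly_Mapping.keys q" by auto
    with assms show ?thesis by (simp add: polys_def keys_nat_add)
  qed
  then show ?thesis by (simp add: polys_def)
qed

interpretation mpoly: real_subalgebra "polys V" mconst for V :: "'v set"
  by unfold_locales (auto simp: mconst_add mconst_mult mconst_1 mconst_polys add_polys mult_polys)

lemma sum_polys: "(\<And>i. i \<in> I \<Longrightarrow> f i \<in> polys V) \<Longrightarrow> sum f I \<in> polys V"
  by (induction I rule: infinite_finite_induct) (auto intro: mpoly.zero_mem add_polys)

text \<open>
  The rule carries membership of the summands and factors, so that it applies to maps that are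
  multiplicative on \<open>polys V\<close> only.
\<close>

lemma polys_induct [consumes 1, case_names const var add mult]:
  assumes p: "p \<in> polys V"
    and const: "\<And>r. P (mconst r)"
    and var: "\<And>v. v \<in> V \<Longrightarrow> P (mvar v)"
    and add: "\<And>p q. p \<in> polys V \<Longrightarrow> q \<in> polys V \<Longrightarrow> P p \<Longrightarrow> P q \<Longrightarrow> P (p + q)"
    and mult: "\<And>p q. p \<in> polys V \<Longrightarrow> q \<in> polys V \<Longrightarrow> P p \<Longrightarrow> P q \<Longrightarrow> P (p * q)"
  shows "P p"
proof -
  define B where "B = {p \<in> polys V. P p}"
  have B: "mconst r \<in> B" "v \<in> V \<Longrightarrow> mvar v \<in> B" "q \<in> B \<Longrightarrow> q' \<in> B \<Longrightarrow> q + q' \<in> B"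
    "q \<in> B \<Longrightarrow> q' \<in> B \<Longrightarrow> q * q' \<in> B" for r v q q'
    using const var add mult by (auto simp: B_def mconst_polys mvar_polys add_polys mult_polys)
  have B01: "0 \<in> B" "1 \<in> B"
    using B(1)[of 0] B(1)[of 1] by (simp_all add: mconst_def)
  have pow: "Poly_Mapping.single (Poly_Mapping.single v n) 1 \<in> B" if "v \<in> V" for v n
  proof (induction n)
    case (Suc n)
    have "Poly_Mapping.single (Poly_Mapping.single v (Suc n)) (1::real)
        = mvar v * Poly_Mapping.single (Poly_Mapping.single v n) 1"
      by (simp add: mvar_def mult_single flip: single_add)
    with Suc B(2)[OF that] show ?case by (simp add: B(4))
  qed (simp add: B01)
  have mon: "Poly_Mapping.single (\<Sum>v\<in>F. Poly_Mapping.single v (e v)) 1 \<in> B"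
    if "finite F" "F \<subseteq> V" for F and e :: "'a \<Rightarrow> nat"
    using that
  proof (induction F rule: finite_induct)
    case (insert v F)
    have "Poly_Mapping.single (\<Sum>v\<in>insert v F. Poly_Mapping.single v (e v)) (1::real)
        = Poly_Mapping.single (Poly_Mapping.single v (e v)) 1
          * Poly_Mapping.single (\<Sum>v\<in>F. Poly_Mapping.single v (e v)) 1"
      using insert.hyps by (simp add: mult_single)
    with insert show ?case by (simp add: B(4) pow)
  qed (simp add: B01)
  have single: "Poly_Mapping.single m r \<in> B" if "Poly_Mapping.keys m \<subseteq> V" for m r
  proof -
    have "m = (\<Sum>v\<in>Poly_Mapping.keys m. Poly_Mapping.single v (Poly_Mapping.lookup m v))"
      by (rule poly_mapping_eqI) (auto simp: lookup_sum lookup_single when_def in_keys_iff)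
    with mon[OF _ that, of "Poly_Mapping.lookup m"] have "Poly_Mapping.single m 1 \<in> B" by simp
    moreover have "Poly_Mapping.single m r = mconst r * Poly_Mapping.single m 1"
      by (simp add: mconst_def mult_single)
    ultimately show ?thesis by (simp add: B(1,4))
  qed
  have sum: "sum f I \<in> B" if "\<And>i. i \<in> I \<Longrightarrow> f i \<in> B" for f and I :: "('a \<Rightarrow>\<^sub>0 nat) set"
    using that by (induction I rule: infinite_finite_induct) (auto intro: B01 B(3))
  have "p \<in> B"
    using p by (subst mpoly_eq_sum_single[of p], intro sum single) (auto simp: polys_def)
  then show ?thesis by (simp add: B_def)
qed

lemma character_eq_meval:
  assumes "mpoly.character V \<phi>" "p \<in> polys V"
  shows "\<phi> p = meval (\<lambda>v\<in>V. \<phi> (mvar v)) p"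
proof -
  have \<phi>: "\<And>r. \<phi> (mconst r) = r"
    "\<And>p q. p \<in> polys V \<Longrightarrow> q \<in> polys V \<Longrightarrow> \<phi> (p + q) = \<phi> p + \<phi> q"
    "\<And>p q. p \<in> polys V \<Longrightarrow> q \<in> polys V \<Longrightarrow> \<phi> (p * q) = \<phi> p * \<phi> q"
    using assms(1) unfolding mpoly.character_def by simp_all
  show ?thesis
    using assms(2) by (induction rule: polys_induct) (simp_all add: \<phi>)
qed

lemma deg_le_mono: "deg_le p k \<Longrightarrow> k \<le> l \<Longrightarrow> deg_le p l"
  unfolding deg_le_def by fastforce

lemma eventually_deg_le: "\<forall>\<^sub>F k in sequentially. deg_le p k"
  unfolding deg_le_def by (rule eventually_ball_finite) (auto intro: eventually_ge_at_top)


section \<open>The quadratic module of a semialgebraic description\<close>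

lemma sos_eq_sqsums: "sos V = mpoly.sqsums V"
proof (intro equalityI subsetI)
  fix p assume "p \<in> sos V"
  then obtain n :: nat and q where p: "p = (\<Sum>i<n. (q i)\<^sup>2)" and q: "\<forall>i<n. q i \<in> polys V"
    by (auto simp: sos_def)
  have "(\<Sum>i<n. (q i)\<^sup>2) \<in> mpoly.sqsums V"
    using q by (induction n) (auto simp: add.commute intro: mpoly.sqsums.intros)
  with p show "p \<in> mpoly.sqsums V" by simp
next
  fix p assume "p \<in> mpoly.sqsums V"
  then show "p \<in> sos V"
  proof (induction rule: mpoly.sqsums.induct)
    case zero
    show ?case unfolding sos_def by (auto intro!: exI[of _ 0])
  next
    case (step a t)
    then obtain n :: nat and q where t: "t = (\<Sum>i<n. (q i)\<^sup>2)" "\<forall>i<n. q i \<in> polys V"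
      by (auto simp: sos_def)
    let ?q = "q(n := a)"
    have "a\<^sup>2 + t = (\<Sum>i<Suc n. (?q i)\<^sup>2)" using t(1) by (simp add: add.commute)
    moreover have "\<forall>i<Suc n. ?q i \<in> polys V" using t(2) step.hyps(1) by (auto simp: less_Suc_eq)
    ultimately show ?case
      unfolding sos_def by (intro CollectI exI[of _ "Suc n"] exI[of _ ?q] conjI)
  qed
qed

lemma qmod_le_subset_qmod: "qmod_le V gs hs D \<subseteq> qmod V gs hs"
  unfolding qmod_def qmod_le_def by auto

lemma qmod_le_mono: "D \<le> E \<Longrightarrow> qmod_le V gs hs D \<subseteq> qmod_le V gs hs E"
proof
  fix p assume DE: "D \<le> E" and "p \<in> qmod_le V gs hs D"
  then obtain \<sigma>0 \<sigma> \<phi> where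
    p: "p = \<sigma>0 + (\<Sum>k<length gs. \<sigma> k * gs ! k) + (\<Sum>j<length hs. \<phi> j * hs ! j)" "\<sigma>0 \<in> sos V"
      "\<forall>k<length gs. \<sigma> k \<in> sos V" "\<forall>j<length hs. \<phi> j \<in> polys V"
    and deg: "deg_le \<sigma>0 D" "\<forall>k<length gs. deg_le (\<sigma> k * gs ! k) D"
      "\<forall>j<length hs. deg_le (\<phi> j * hs ! j) D"
    unfolding qmod_le_def by blast
  have "deg_le \<sigma>0 E" "\<forall>k<length gs. deg_le (\<sigma> k * gs ! k) E"
      "\<forall>j<length hs. deg_le (\<phi> j * hs ! j) E"
    using deg DE by (auto intro: deg_le_mono)
  with p show "p \<in> qmod_le V gs hs E" unfolding qmod_le_def by blast
qed

lemma eventually_qmod_le: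
  assumes "p \<in> qmod V gs hs"
  shows "\<forall>\<^sub>F D in sequentially. p \<in> qmod_le V gs hs D"
proof -
  from assms obtain \<sigma>0 \<sigma> \<phi> where
    p: "p = \<sigma>0 + (\<Sum>k<length gs. \<sigma> k * gs ! k) + (\<Sum>j<length hs. \<phi> j * hs ! j)" "\<sigma>0 \<in> sos V"
      "\<forall>k<length gs. \<sigma> k \<in> sos V" "\<forall>j<length hs. \<phi> j \<in> polys V"
    unfolding qmod_def by blast
  have "\<forall>\<^sub>F D in sequentially. \<forall>k\<in>{..<length gs}. deg_le (\<sigma> k * gs ! k) D"
    "\<forall>\<^sub>F D in sequentially. \<forall>j\<in>{..<length hs}. deg_le (\<phi> j * hs ! j) D"
    by (intro eventually_ball_finite ballI eventually_deg_le finite_lessThan)+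
  with eventually_deg_le[of \<sigma>0] show ?thesis
  proof eventually_elim
    case (elim D)
    then show ?case unfolding qmod_le_def using p by blast
  qed
qed

lemma qmod_quadratic_module:
  assumes "set gs \<subseteq> polys V" "set hs \<subseteq> polys V"
  shows "mpoly.quadratic_module V (qmod V gs hs)"
proof -
  let ?Q = "qmod V gs hs"
  have QI: "\<sigma>0 + (\<Sum>k<length gs. \<sigma> k * gs ! k) + (\<Sum>j<length hs. \<phi> j * hs ! j) \<in> ?Q"
    if "\<sigma>0 \<in> sos V" "\<forall>k<length gs. \<sigma> k \<in> sos V" "\<forall>j<length hs. \<phi> j \<in> polys V" for \<sigma>0 \<sigma> \<phi>
    unfolding qmod_def using that by blast
  have QE: thesis if "p \<in> ?Q" and
    "\<And>\<sigma>0 \<sigma> \<phi>. p = \<sigma>0 + (\<Sum>k<length gs. \<sigma> k * gs ! k) + (\<Sum>j<length hs. \<phi> j * hs ! j) \<Longrightarrow>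
      \<sigma>0 \<in> sos V \<Longrightarrow> \<forall>k<length gs. \<sigma> k \<in> sos V \<Longrightarrow> \<forall>j<length hs. \<phi> j \<in> polys V \<Longrightarrow> thesis"
    for p thesis
    using that unfolding qmod_def by blast
  have nth: "gs ! k \<in> polys V" if "k < length gs" for k
    using assms(1) that nth_mem by blast
  have nth': "hs ! k \<in> polys V" if "k < length hs" for k
    using assms(2) that nth_mem by blast
  have "p \<in> polys V" if "p \<in> ?Q" for p
    using that by (rule QE)
      (auto intro!: add_polys sum_polys mult_polys nth nth' simp: sos_eq_sqsums mpoly.sqsums_mem)
  moreover have "1 \<in> ?Q"
    using QI[of 1 "\<lambda>_. 0" "\<lambda>_. 0"] mpoly.power2_sqsums[OF mpoly.one_mem, of V]
    by (simp add: sos_eq_sqsums mpoly.sqsums.zero mpoly.zero_mem)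
  moreover have "p + q \<in> ?Q" if pq: "p \<in> ?Q" "q \<in> ?Q" for p q
  proof (rule QE[OF pq(1)], rule QE[OF pq(2)])
    fix \<sigma>0 \<sigma> \<phi> \<sigma>0' \<sigma>' \<phi>'
    assume p: "p = \<sigma>0 + (\<Sum>k<length gs. \<sigma> k * gs ! k) + (\<Sum>j<length hs. \<phi> j * hs ! j)"
      and q: "q = \<sigma>0' + (\<Sum>k<length gs. \<sigma>' k * gs ! k) + (\<Sum>j<length hs. \<phi>' j * hs ! j)"
      and *: "\<sigma>0 \<in> sos V" "\<forall>k<length gs. \<sigma> k \<in> sos V" "\<forall>j<length hs. \<phi> j \<in> polys V"
       "\<sigma>0' \<in> sos V" "\<forall>k<length gs. \<sigma>' k \<in> sos V" "\<forall>j<length hs. \<phi>' j \<in> polys V"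
    have "p + q = (\<sigma>0 + \<sigma>0') + (\<Sum>k<length gs. (\<sigma> k + \<sigma>' k) * gs ! k)
        + (\<Sum>j<length hs. (\<phi> j + \<phi>' j) * hs ! j)"
      unfolding p q by (simp add: distrib_right sum.distrib)
    then show ?thesis
      using * QI[of "\<sigma>0 + \<sigma>0'" "\<lambda>k. \<sigma> k + \<sigma>' k" "\<lambda>j. \<phi> j + \<phi>' j"]
      by (simp add: sos_eq_sqsums mpoly.sqsums_add add_polys)
  qed
  moreover have "a\<^sup>2 * p \<in> ?Q" if ap: "a \<in> polys V" "p \<in> ?Q" for a p
  proof (rule QE[OF ap(2)])
    fix \<sigma>0 \<sigma> \<phi>
    assume p: "p = \<sigma>0 + (\<Sum>k<length gs. \<sigma> k * gs ! k) + (\<Sum>j<length hs. \<phi> j * hs ! j)"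
      and *: "\<sigma>0 \<in> sos V" "\<forall>k<length gs. \<sigma> k \<in> sos V" "\<forall>j<length hs. \<phi> j \<in> polys V"
    have "a\<^sup>2 * p = (a\<^sup>2 * \<sigma>0) + (\<Sum>k<length gs. (a\<^sup>2 * \<sigma> k) * gs ! k)
        + (\<Sum>j<length hs. (a\<^sup>2 * \<phi> j) * hs ! j)"
      unfolding p by (simp add: distrib_left sum_distrib_left mult.assoc)
    then show ?thesis
      using * ap(1) QI[of "a\<^sup>2 * \<sigma>0" "\<lambda>k. a\<^sup>2 * \<sigma> k" "\<lambda>j. a\<^sup>2 * \<phi> j"]
      by (simp add: sos_eq_sqsums mpoly.power2_mult_sqsums mpoly.power2_mem mult_polys)
  qed
  ultimately show ?thesis unfolding mpoly.quadratic_module_def by auto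
qed

lemma ineq_mem_qmod:
  assumes "g \<in> set gs"
  shows "g \<in> qmod V gs hs"
proof -
  from assms obtain k where k: "k < length gs" "gs ! k = g" by (auto simp: in_set_conv_nth)
  have 1: "1 \<in> sos V" and 0: "0 \<in> sos V"
    using mpoly.power2_sqsums[OF mpoly.one_mem, of V]
    by (simp_all add: sos_eq_sqsums mpoly.sqsums.zero)
  have "g = 0 + (\<Sum>i<length gs. (if i = k then 1 else 0) * gs ! i) + (\<Sum>j<length hs. 0 * hs ! j)"
    using k by (simp add: if_distrib[of "\<lambda>x. x * _"] cong: if_cong)
  then show ?thesis
    unfolding qmod_def using 0 1 mpoly.zero_mem[of V]
    by (intro CollectI exI[of _ 0] exI[of _ "\<lambda>i. if i = k then 1 else 0"] exI[of _ "\<lambda>_. 0"]) simp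
qed

lemma eq_mult_mem_qmod:
  assumes "h \<in> set hs" "p \<in> polys V"
  shows "p * h \<in> qmod V gs hs"
proof -
  from assms obtain k where k: "k < length hs" "hs ! k = h" by (auto simp: in_set_conv_nth)
  have 0: "0 \<in> sos V" by (simp_all add: sos_eq_sqsums mpoly.sqsums.zero)
  have "p * h = 0 + (\<Sum>i<length gs. 0 * gs ! i) + (\<Sum>j<length hs. (if j = k then p else 0) * hs ! j)"
    using k by (simp add: if_distrib[of "\<lambda>x. x * _"] cong: if_cong)
  then show ?thesis
    unfolding qmod_def using 0 assms(2) mpoly.zero_mem[of V]
    by (intro CollectI exI[of _ 0] exI[of _ "\<lambda>j. if j = k then p else 0"] exI[of _ "\<lambda>_. 0"]) simp
qed

lemma sos_nonneg: "p \<in> sos V \<Longrightarrow> 0 \<le> meval x p"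
  by (auto simp: sos_def power2_eq_square intro!: sum_nonneg)

lemma qmod_nonneg:
  assumes "p \<in> qmod V gs hs" "x \<in> semialg V gs hs"
  shows "0 \<le> meval x p"
proof -
  from assms(1) obtain \<sigma>0 \<sigma> \<phi> where
    p: "p = \<sigma>0 + (\<Sum>k<length gs. \<sigma> k * gs ! k) + (\<Sum>j<length hs. \<phi> j * hs ! j)" "\<sigma>0 \<in> sos V"
      "\<forall>k<length gs. \<sigma> k \<in> sos V"
    unfolding qmod_def by blast
  have "meval x (gs ! k) \<ge> 0" if "k < length gs" for k
    using assms(2) that by (auto simp: semialg_def)
  moreover have "meval x (hs ! j) = 0" if "j < length hs" for j
    using assms(2) that by (auto simp: semialg_def)
  ultimately show ?thesis
    using p by (auto intro!: add_nonneg_nonneg sum_nonneg mult_nonneg_nonneg intro: sos_nonneg)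
qed

text \<open>
  Adding the squares of the other variables to \<open>R - \<Sum>\<^sub>v v\<^sup>2\<close> leaves \<open>R - v\<^sup>2\<close>, so every variable is a
  bounded element, and with the variables every polynomial.
\<close>

lemma archimedean_bounded:
  assumes fin: "finite V" and sub: "set gs \<subseteq> polys V" "set hs \<subseteq> polys V"
    and arch: "archimedean V gs hs"
  shows "polys V \<subseteq> mpoly.bounded_elements V (qmod V gs hs)"
proof
  note M = qmod_quadratic_module[OF sub]
  from arch obtain R where R: "mconst R - (\<Sum>v\<in>V. (mvar v)\<^sup>2) \<in> qmod V gs hs"
    unfolding archimedean_def by blast
  have add_sum: "x + (\<Sum>w\<in>W. (mvar w)\<^sup>2) \<in> qmod V gs hs"
    if "finite W" "W \<subseteq> V" "x \<in> qmod V gs hs" for W x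
    using that
  proof (induction W arbitrary: x rule: finite_induct)
    case (insert w W)
    then have "x + (mvar w)\<^sup>2 \<in> qmod V gs hs"
      by (intro mpoly.qm_add[OF M] mpoly.qm_sq[OF M] mvar_polys) auto
    with insert show ?case by (simp add: add.assoc[symmetric])
  qed simp
  fix p assume "p \<in> polys V"
  then show "p \<in> mpoly.bounded_elements V (qmod V gs hs)"
  proof (induction rule: polys_induct)
    case (var v)
    have "mconst R - (\<Sum>v\<in>V. (mvar v)\<^sup>2) + (\<Sum>w\<in>V - {v}. (mvar w)\<^sup>2) \<in> qmod V gs hs"
      using fin R by (intro add_sum) auto
    then have "mconst R - (mvar v)\<^sup>2 \<in> qmod V gs hs"
      using var fin by (simp add: sum.remove[of V v])
    then show ?case using var by (intro mpoly.bounded_if_square_bounded[OF M] mvar_polys)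
  qed (simp_all add: mpoly.c_bounded[OF M] mpoly.add_bounded[OF M] mpoly.mult_bounded[OF M])
qed

text \<open>
  A character nonnegative on the quadratic module is the evaluation at a point, and that point
  satisfies the constraints: each \<open>g\<close> and both of \<open>\<plusminus> h\<close> belong to the module.
\<close>

theorem putinar_positivstellensatz:
  assumes fin: "finite V" and sub: "set gs \<subseteq> polys V" "set hs \<subseteq> polys V"
    and arch: "archimedean V gs hs"
    and f: "f \<in> polys V" and pos: "\<And>x. x \<in> semialg V gs hs \<Longrightarrow> 0 < meval x f"
  shows "f \<in> qmod V gs hs"
proof (rule mpoly.positive_on_characters[OF qmod_quadratic_module[OF sub] _ f])
  show "mpoly.bounded_by_constants V (qmod V gs hs)"
    using archimedean_bounded[OF fin sub arch]
    unfolding mpoly.bounded_by_constants_def mpoly.bounded_elements_def by blast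
next
  fix \<phi> assume \<phi>: "mpoly.character V \<phi>" and nonneg: "\<forall>x\<in>qmod V gs hs. 0 \<le> \<phi> x"
  define x where "x = (\<lambda>v\<in>V. \<phi> (mvar v))"
  have eval: "meval x p = \<phi> p" if "p \<in> polys V" for p
    using character_eq_meval[OF \<phi> that] by (simp add: x_def)
  have "0 \<le> meval x g" if "g \<in> set gs" for g
    using that sub nonneg ineq_mem_qmod[of g gs V hs] by (auto simp: eval subset_iff)
  moreover have "meval x h = 0" if "h \<in> set hs" for h
  proof -
    have "h \<in> polys V" using that sub by auto
    moreover have "mconst 1 * h \<in> qmod V gs hs" "mconst (- 1) * h \<in> qmod V gs hs"
      using that by (auto intro: eq_mult_mem_qmod mconst_polys)
    ultimately have "0 \<le> meval x (mconst 1 * h)" "0 \<le> meval x (mconst (- 1) * h)"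
      using nonneg by (simp_all only: eval mult_polys mconst_polys)
    then show ?thesis by simp
  qed
  moreover have "x \<in> V \<rightarrow>\<^sub>E UNIV" by (simp add: x_def)
  ultimately have "x \<in> semialg V gs hs" by (simp add: semialg_def)
  from pos[OF this] show "0 < \<phi> f" by (simp add: eval f)
qed


section \<open>Polynomial majorants of absolute values\<close>

lemma meval_power: "meval x (p ^ n) = meval x p ^ n"
  by (induction n) auto

lemma power_polys: "p \<in> polys V \<Longrightarrow> p ^ n \<in> polys V"
  by (induction n) (auto intro: mpoly.one_mem mult_polys)

text \<open>
  The majorant is a polynomial in \<open>p\<close>: a one-variable Weierstrass approximation of \<open>\<bar>s\<bar>\<close> on
  \<open>[- B, B]\<close>, lifted by half the tolerance. So it uses no variables besides those of \<open>p\<close>.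
\<close>

lemma polynomial_majorant_of_abs:
  assumes p: "p \<in> polys W" and B: "\<And>x. x \<in> K \<Longrightarrow> \<bar>meval x p\<bar> \<le> B" and \<delta>: "0 < \<delta>"
  shows "\<exists>m\<in>polys W. \<forall>x\<in>K. \<bar>meval x p\<bar> < meval x m \<and> meval x m < \<bar>meval x p\<bar> + \<delta>"
proof -
  obtain g where g: "real_polynomial_function g"
    and approx: "\<And>s. s \<in> {- B..B} \<Longrightarrow> \<bar>\<bar>s\<bar> - g s\<bar> < \<delta> / 2"
  proof (rule Stone_Weierstrass_real_polynomial_function[of "{- B..B}" "abs :: real \<Rightarrow> real" "\<delta> / 2"])
    show "continuous_on {- B..B} (abs :: real \<Rightarrow> real)" by (intro continuous_intros)
  qed (use \<delta> in auto)
  from g obtain a and n :: nat where a: "g = (\<lambda>s. \<Sum>i\<le>n. a i * s ^ i)"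
    unfolding real_polynomial_function_iff_sum by blast
  define m where "m = mconst (\<delta> / 2) + (\<Sum>i\<le>n. mconst (a i) * p ^ i)"
  have "m \<in> polys W"
    unfolding m_def by (intro add_polys sum_polys mult_polys mconst_polys power_polys p)
  moreover have "\<bar>meval x p\<bar> < meval x m \<and> meval x m < \<bar>meval x p\<bar> + \<delta>" if "x \<in> K" for x
  proof -
    have "meval x m = \<delta> / 2 + g (meval x p)"
      by (simp add: m_def a meval_power)
    moreover have "\<bar>\<bar>meval x p\<bar> - g (meval x p)\<bar> < \<delta> / 2"
      using B[OF that] by (intro approx) auto
    ultimately show ?thesis by linarith
  qed
  ultimately show ?thesis by blast
qed


section \<open>The closed loop\<close>

lemma finite_arx_vars: "finite (arx_vars na nb T)"
  by (simp add: arx_vars_def ab_vars_def)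

lemma polys_mono: "V \<subseteq> W \<Longrightarrow> polys V \<subseteq> polys W"
  unfolding polys_def by auto

lemma ab_vars_subset: "ab_vars na nb \<subseteq> arx_vars na nb T"
  by (auto simp: arx_vars_def)

lemma Pbar_ineqs_polys: "set (Pbar_ineqs na nb T \<epsilon>u \<epsilon>y) \<subseteq> polys (arx_vars na nb T)"
  unfolding Pbar_ineqs_def
  by (auto simp: arx_vars_def intro!: add_polys mpoly.diff_mem mconst_polys mvar_polys)

lemma Pbar_eqs_polys: "set (Pbar_eqs na nb T uh yh) \<subseteq> polys (arx_vars na nb T)"
  unfolding Pbar_eqs_def h_poly_def
  by (auto simp: arx_vars_def ab_vars_def
      intro!: add_polys mpoly.diff_mem mconst_polys mvar_polys sum_polys mult_polys)

lemma coeff_one_plus_lag_poly_polys: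
  assumes "\<And>i. i \<in> {1..n} \<Longrightarrow> f i \<in> polys V"
  shows "Polynomial.coeff (1 + lag_poly n f) i \<in> polys V" "Polynomial.coeff (lag_poly n f) i \<in> polys V"
  using assms mpoly.zero_mem[of V] mpoly.one_mem[of V]
  by (auto simp: coeff_lag_poly Polynomial.coeff_1 intro: add_polys)

lemma acl_poly_polys: "acl_poly na nb nta ntb ta tb i \<in> polys (ab_vars na nb)"
proof -
  let ?W = "ab_vars na nb"
  let ?P = "polys ?W"
  have "mvar (VA i) \<in> ?P" if "i \<in> {1..na}" for i
    using that by (intro mvar_polys) (auto simp: ab_vars_def)
  moreover have "mvar (VB i) \<in> ?P" if "i \<in> {1..nb}" for i
    using that by (intro mvar_polys) (auto simp: ab_vars_def)
  moreover have "Polynomial.coeff 1 i \<in> ?P"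
    using mpoly.zero_mem[of ?W] mpoly.one_mem[of ?W] by (simp add: Polynomial.coeff_1)
  ultimately show ?thesis
    unfolding acl_poly_def acl_def Polynomial.coeff_diff Polynomial.coeff_add[of "_ * _"]
      Polynomial.coeff_mult
    by (intro mpoly.diff_mem add_polys sum_polys mult_polys coeff_one_plus_lag_poly_polys mconst_polys)
qed

context
  fixes na nb nta ntb T :: nat
    and \<epsilon>u \<epsilon>y :: real
    and uh yh :: "int \<Rightarrow> real"
begin

private abbreviation (input) "V \<equiv> arx_vars na nb T"
private abbreviation (input) "gs \<equiv> Pbar_ineqs na nb T \<epsilon>u \<epsilon>y"
private abbreviation (input) "hs \<equiv> Pbar_eqs na nb T uh yh"
private abbreviation (input) "aclp \<equiv> acl_poly na nb nta ntb"

text \<open>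
  The degree bound \<open>D\<close> takes the place of \<open>2d\<close>, since the Positivstellensatz supplies certificates of
  some degree without regard to parity.
\<close>

definition sos_feasible ::
    "nat \<Rightarrow> real \<Rightarrow> (nat \<Rightarrow> real) \<Rightarrow> (nat \<Rightarrow> real) \<Rightarrow> (nat \<Rightarrow> arx_var mpoly) \<Rightarrow> bool" where
  "sos_feasible D \<gamma> ta tb m \<longleftrightarrow>
     (\<forall>i\<in>{1..na+nta}. m i \<in> polys_le (ab_vars na nb) D) \<and>
     mconst \<gamma> - (\<Sum>i=1..na+nta. m i) \<in> qmod_le V gs hs D \<and>
     (\<forall>i\<in>{1..na+nta}. m i - aclp ta tb i \<in> qmod_le V gs hs D) \<and>
     (\<forall>i\<in>{1..na+nta}. m i + aclp ta tb i \<in> qmod_le V gs hs D)"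

lemma gamma_sos_eq:
  "gamma_sos na nb nta ntb T \<epsilon>u \<epsilon>y uh yh d =
     Inf {ereal \<gamma> | \<gamma> ta tb m. ta \<in> {1..nta} \<rightarrow>\<^sub>E UNIV \<and> tb \<in> {1..ntb} \<rightarrow>\<^sub>E UNIV \<and>
            sos_feasible (2 * d) \<gamma> ta tb m}"
  unfolding gamma_sos_def sos_feasible_def Let_def by (simp add: conj_assoc)

lemma sos_feasible_mono:
  assumes "sos_feasible D \<gamma> ta tb m" "D \<le> E"
  shows "sos_feasible E \<gamma> ta tb m"
proof -
  have "qmod_le V gs hs D \<subseteq> qmod_le V gs hs E"
    using assms(2) by (rule qmod_le_mono)
  moreover have "polys_le (ab_vars na nb) D \<subseteq> polys_le (ab_vars na nb) E"
    using assms(2) by (auto simp: polys_le_def intro: deg_le_mono)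
  ultimately show ?thesis
    using assms(1) unfolding sos_feasible_def by (meson subsetD)
qed

lemma sos_feasible_bound:
  assumes "sos_feasible D \<gamma> ta tb m" and x: "x \<in> Pbar na nb T \<epsilon>u \<epsilon>y uh yh"
  shows "(\<Sum>i=1..na+nta. \<bar>acl na nb nta ntb (\<lambda>i. x (VA i)) (\<lambda>i. x (VB i)) ta tb i\<bar>) \<le> \<gamma>"
proof -
  have nonneg: "0 \<le> meval x p" if "p \<in> qmod_le V gs hs D" for p
    using qmod_nonneg[OF subsetD[OF qmod_le_subset_qmod that]] x by (simp add: Pbar_def)
  have "(\<Sum>i=1..na+nta. \<bar>meval x (aclp ta tb i)\<bar>) \<le> (\<Sum>i=1..na+nta. meval x (m i))"
  proof (rule sum_mono)
    fix i assume "i \<in> {1..na+nta}"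
    then have "0 \<le> meval x (m i - aclp ta tb i)" "0 \<le> meval x (m i + aclp ta tb i)"
      using assms(1) by (auto simp: sos_feasible_def simp del: meval_diff meval_add intro!: nonneg)
    then show "\<bar>meval x (aclp ta tb i)\<bar> \<le> meval x (m i)" by (simp add: abs_le_iff)
  qed
  also have "0 \<le> meval x (mconst \<gamma> - (\<Sum>i=1..na+nta. m i))"
    using assms(1) by (intro nonneg) (simp add: sos_feasible_def)
  then have "(\<Sum>i=1..na+nta. meval x (m i)) \<le> \<gamma>" by simp
  finally show ?thesis by (simp add: meval_acl_poly)
qed

text \<open>
  Given a controller of worst-case norm at most \<open>\<gamma>\<close>, take for \<open>m i\<close> a polynomial majorant of
  \<open>\<bar>a\<^sup>c\<^sup>l\<^sub>i\<bar>\<close> so tight that all \<open>na + nta\<close> errors together stay below \<open>\<epsilon>\<close>. Then every constraint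
  polynomial is strictly positive on the consistency set, so the Positivstellensatz certifies it,
  and the finitely many certificates all fit below some degree.
\<close>

lemma eventually_sos_feasible:
  assumes arch: "archimedean V gs hs" and \<epsilon>: "0 < \<epsilon>"
    and \<gamma>: "\<And>x. x \<in> Pbar na nb T \<epsilon>u \<epsilon>y uh yh \<Longrightarrow>
      (\<Sum>i=1..na+nta. \<bar>acl na nb nta ntb (\<lambda>i. x (VA i)) (\<lambda>i. x (VB i)) ta tb i\<bar>) \<le> \<gamma>"
  shows "\<exists>m. \<forall>\<^sub>F D in sequentially. sos_feasible D (\<gamma> + \<epsilon>) ta tb m"
proof -
  let ?K = "semialg V gs hs" and ?I = "{1..na+nta}" and ?W = "ab_vars na nb"
  note sub = Pbar_ineqs_polys[of na nb T \<epsilon>u \<epsilon>y] Pbar_eqs_polys[of na nb T uh yh]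
  have WV: "p \<in> polys V" if "p \<in> polys ?W" for p
    using polys_mono[OF ab_vars_subset] that by blast
  have putinar: "p \<in> qmod V gs hs" if "p \<in> polys V" "\<And>x. x \<in> ?K \<Longrightarrow> 0 < meval x p" for p
    using putinar_positivstellensatz[OF finite_arx_vars sub arch that] .
  define \<delta> where "\<delta> = \<epsilon> / (real (na + nta) + 1)"
  have \<delta>: "0 < \<delta>" "real (na + nta) * \<delta> < \<epsilon>"
    using \<epsilon> by (auto simp: \<delta>_def field_simps)
  have "\<exists>q\<in>polys ?W. \<forall>x\<in>?K. \<bar>meval x (aclp ta tb i)\<bar> < meval x q
      \<and> meval x q < \<bar>meval x (aclp ta tb i)\<bar> + \<delta>" for i
  proof -
    let ?p = "aclp ta tb i"
    have "?p \<in> mpoly.bounded_elements V (qmod V gs hs)"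
      using archimedean_bounded[OF finite_arx_vars sub arch] WV[OF acl_poly_polys] by (rule subsetD)
    then obtain B where B: "mconst B - ?p \<in> qmod V gs hs" "mconst B + ?p \<in> qmod V gs hs"
      unfolding mpoly.bounded_elements_def by auto
    show ?thesis
    proof (rule polynomial_majorant_of_abs[OF acl_poly_polys _ \<delta>(1)])
      fix x assume "x \<in> ?K"
      from qmod_nonneg[OF B(1) this] qmod_nonneg[OF B(2) this]
      show "\<bar>meval x ?p\<bar> \<le> B" by simp
    qed
  qed
  then obtain m where mW: "\<And>i. m i \<in> polys ?W"
    and lower: "\<And>i x. x \<in> ?K \<Longrightarrow> \<bar>meval x (aclp ta tb i)\<bar> < meval x (m i)"
    and upper: "\<And>i x. x \<in> ?K \<Longrightarrow> meval x (m i) < \<bar>meval x (aclp ta tb i)\<bar> + \<delta>"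
    by metis
  have "mconst (\<gamma> + \<epsilon>) - (\<Sum>i\<in>?I. m i) \<in> qmod V gs hs"
  proof (rule putinar)
    fix x assume x: "x \<in> ?K"
    have "(\<Sum>i\<in>?I. meval x (m i)) \<le> (\<Sum>i\<in>?I. \<bar>meval x (aclp ta tb i)\<bar> + \<delta>)"
      using upper[OF x] by (intro sum_mono less_imp_le)
    also have "\<dots> = (\<Sum>i\<in>?I. \<bar>meval x (aclp ta tb i)\<bar>) + real (na + nta) * \<delta>"
      by (simp add: sum.distrib)
    also have "\<dots> < \<gamma> + \<epsilon>"
      using \<gamma>[of x] x \<delta>(2) by (simp add: Pbar_def meval_acl_poly)
    finally show "0 < meval x (mconst (\<gamma> + \<epsilon>) - (\<Sum>i\<in>?I. m i))" by simp
  qed (intro mpoly.diff_mem mconst_polys sum_polys WV mW)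
  moreover have "m i - aclp ta tb i \<in> qmod V gs hs" for i
  proof (rule putinar)
    fix x assume "x \<in> ?K"
    from lower[OF this, of i] show "0 < meval x (m i - aclp ta tb i)" by simp
  qed (intro mpoly.diff_mem WV mW acl_poly_polys)
  moreover have "m i + aclp ta tb i \<in> qmod V gs hs" for i
  proof (rule putinar)
    fix x assume "x \<in> ?K"
    from lower[OF this, of i] show "0 < meval x (m i + aclp ta tb i)" by simp
  qed (intro add_polys WV mW acl_poly_polys)
  moreover have "\<forall>\<^sub>F D in sequentially. m i \<in> polys_le ?W D" for i
    using eventually_deg_le[of "m i"] by eventually_elim (simp add: polys_le_def mW)
  ultimately have "\<forall>\<^sub>F D in sequentially. sos_feasible D (\<gamma> + \<epsilon>) ta tb m"
    unfolding sos_feasible_def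
    by (intro eventually_conj eventually_ball_finite ballI eventually_qmod_le) auto
  then show ?thesis by blast
qed

lemma gamma_sos_antimono:
  assumes "d \<le> e"
  shows "gamma_sos na nb nta ntb T \<epsilon>u \<epsilon>y uh yh e \<le> gamma_sos na nb nta ntb T \<epsilon>u \<epsilon>y uh yh d"
proof -
  have "sos_feasible (2 * e) \<gamma> ta tb m" if "sos_feasible (2 * d) \<gamma> ta tb m" for \<gamma> ta tb m
    using that assms by (intro sos_feasible_mono[OF that]) auto
  then show ?thesis
    unfolding gamma_sos_eq by (intro Inf_superset_mono Collect_mono impI) metis
qed

lemma gamma_star_le_gamma_sos:
  "gamma_star na nb nta ntb T \<epsilon>u \<epsilon>y uh yh \<le> gamma_sos na nb nta ntb T \<epsilon>u \<epsilon>y uh yh d"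
  unfolding gamma_star_def gamma_sos_eq
  by (intro Inf_superset_mono Collect_mono impI) (metis sos_feasible_bound)

lemma eventually_gamma_sos_less:
  assumes arch: "archimedean V gs hs" and less: "gamma_star na nb nta ntb T \<epsilon>u \<epsilon>y uh yh < z"
  shows "\<forall>\<^sub>F d in sequentially. gamma_sos na nb nta ntb T \<epsilon>u \<epsilon>y uh yh d < z"
proof -
  from less obtain \<gamma> ta tb where
    t: "ta \<in> {1..nta} \<rightarrow>\<^sub>E UNIV" "tb \<in> {1..ntb} \<rightarrow>\<^sub>E UNIV" and z: "ereal \<gamma> < z"
    and \<gamma>: "\<And>x. x \<in> Pbar na nb T \<epsilon>u \<epsilon>y uh yh \<Longrightarrow>
      (\<Sum>i=1..na+nta. \<bar>acl na nb nta ntb (\<lambda>i. x (VA i)) (\<lambda>i. x (VB i)) ta tb i\<bar>) \<le> \<gamma>"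
    unfolding gamma_star_def Inf_less_iff by auto
  from z obtain r where r: "\<gamma> < r" "ereal r < z"
    using ereal_dense2[OF z] by auto
  from eventually_sos_feasible[OF arch _ \<gamma>, of "r - \<gamma>"] r obtain m where
    "\<forall>\<^sub>F D in sequentially. sos_feasible D r ta tb m" by auto
  moreover have "filterlim (\<lambda>d::nat. 2 * d) sequentially sequentially"
    by (intro filterlim_subseq) (simp add: strict_mono_def)
  ultimately have "\<forall>\<^sub>F d in sequentially. sos_feasible (2 * d) r ta tb m"
    by (rule eventually_compose_filterlim)
  then show ?thesis
  proof eventually_elim
    case (elim d)
    then have "gamma_sos na nb nta ntb T \<epsilon>u \<epsilon>y uh yh d \<le> ereal r"
      unfolding gamma_sos_eq using t by (intro Inf_lower) auto
    from this r(2) show ?case by (rule le_less_trans)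
  qed
qed

end

theorem theorem3p2:
  fixes na nb nta ntb T :: nat
    and \<epsilon>u \<epsilon>y :: real
    and uh yh :: "int \<Rightarrow> real"
  assumes "1 \<le> nb" "nb < na" "1 \<le> T" "0 \<le> \<epsilon>u" "0 \<le> \<epsilon>y"
    and "1 \<le> ntb" "ntb < nta"
    and "data_from_arx na nb T \<epsilon>u \<epsilon>y uh yh"
    and "archimedean (arx_vars na nb T) (Pbar_ineqs na nb T \<epsilon>u \<epsilon>y) (Pbar_eqs na nb T uh yh)"
  shows "(\<forall>d\<ge>1. gamma_sos na nb nta ntb T \<epsilon>u \<epsilon>y uh yh d \<ge> gamma_sos na nb nta ntb T \<epsilon>u \<epsilon>y uh yh (Suc d)
                \<and> gamma_sos na nb nta ntb T \<epsilon>u \<epsilon>y uh yh d \<ge> gamma_star na nb nta ntb T \<epsilon>u \<epsilon>y uh yh)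
       \<and> (\<lambda>d. gamma_sos na nb nta ntb T \<epsilon>u \<epsilon>y uh yh d)
           \<longlonglongrightarrow> gamma_star na nb nta ntb T \<epsilon>u \<epsilon>y uh yh"
proof (intro conjI allI impI)
  fix d :: nat
  show "gamma_sos na nb nta ntb T \<epsilon>u \<epsilon>y uh yh (Suc d) \<le> gamma_sos na nb nta ntb T \<epsilon>u \<epsilon>y uh yh d"
    by (rule gamma_sos_antimono) simp
  show "gamma_star na nb nta ntb T \<epsilon>u \<epsilon>y uh yh \<le> gamma_sos na nb nta ntb T \<epsilon>u \<epsilon>y uh yh d"
    by (rule gamma_star_le_gamma_sos)
next
  show "(\<lambda>d. gamma_sos na nb nta ntb T \<epsilon>u \<epsilon>y uh yh d)
      \<longlonglongrightarrow> gamma_star na nb nta ntb T \<epsilon>u \<epsilon>y uh yh"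
    using eventually_gamma_sos_less[OF assms(9)]
    by (intro decreasing_tendsto) (simp_all add: gamma_star_le_gamma_sos)
qed

end
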